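(* Let $k\geq 2$ be an integer and $\epsilon>0$ a real number. Suppose $h\in\mathbb{R}[x_1,\ldots,x_n]$ is hyperbolic with respect to $\mathbf{e}\in\mathbb{R}^n$, and let $\mathbf{u}_1,\ldots,\mathbf{u}_m\in\Lambda_+(\mathbf{e})$ be such that $\operatorname{rk}(\mathbf{u}_i)\leq 1$ and $\operatorname{tr}(\mathbf{u}_i)\leq\epsilon$ for all $1\leq i\leq m$, and $\mathbf{u}_1+\cdots+\mathbf{u}_m=\mathbf{e}$. Then there is a partition $S_1\cup S_2\cup\cdots\cup S_k=[m]$ such that $$\Big\|\sum_{i\in S_j}\mathbf{u}_i\Big\|\leq \frac1k\,\delta(k\epsilon,m)\quad\text{for each } j\in[k],$$ where $\delta(\alpha,m):=\Big(1-\frac1m+\sqrt{\alpha-\frac1m\big(1-\frac1m\big)}\Big)^2$.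
   Context: A homogeneous polynomial $h\in\mathbb{R}[x_1,\ldots,x_n]$ of degree $d$ is hyperbolic with respect to $\mathbf{e}\in\mathbb{R}^n$ if $h(\mathbf{e})\neq0$ and for every $\mathbf{x}\in\mathbb{R}^n$ the univariate polynomial $t\mapsto h(t\mathbf{e}-\mathbf{x})$ has only real zeros. Writing $h(t\mathbf{e}-\mathbf{x})=h(\mathbf{e})\prod_{j=1}^d(t-\lambda_j(\mathbf{x}))$ with $\lambda_1(\mathbf{x})\geq\cdots\geq\lambda_d(\mathbf{x})$, these are the eigenvalues of $\mathbf{x}$ (with respect to $\mathbf{e}$). The closed hyperbolicity cone is $\Lambda_+(\mathbf{e})=\{\mathbf{x}:\lambda_d(\mathbf{x})\geq0\}$. Define $\operatorname{tr}(\mathbf{x})=\sum_i\lambda_i(\mathbf{x})$, $\operatorname{rk}(\mathbf{x})=\#\{i:\lambda_i(\mathbf{x})\neq0\}$, and $\|\mathbf{x}\|=\max_i|\lambda_i(\mathbf{x})|$. $[m]=\{1,\ldots,m\}$. *)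

theory Defs
  imports "HOL-Analysis.Analysis" "HOL-Library.Multiset"
begin

definition hom_poly :: "nat \<Rightarrow> (real^'n \<Rightarrow> real) \<Rightarrow> bool" where
  "hom_poly d h \<longleftrightarrow>
     (\<exists>A c. finite A \<and> (\<forall>\<alpha>\<in>A. (\<Sum>i\<in>UNIV. \<alpha> i) = d) \<and>
        (\<forall>x. h x = (\<Sum>\<alpha>\<in>A. c \<alpha> * (\<Prod>i\<in>UNIV. (x $ i) ^ (\<alpha> i)))))"

text \<open>Hyperbolicity w.r.t. e: h(e) nonzero and t |-> h(t e - x) has only real zeros,
  i.e. it splits over the reals as h(e) * prod (t - lambda_j) (it has degree d
  and leading coefficient h(e)).\<close>
definition hyperbolic :: "nat \<Rightarrow> (real^'n \<Rightarrow> real) \<Rightarrow> real^'n \<Rightarrow> bool" where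
  "hyperbolic d h e \<longleftrightarrow> hom_poly d h \<and> h e \<noteq> 0 \<and>
     (\<forall>x. \<exists>M :: real multiset. size M = d \<and>
        (\<forall>t. h (t *\<^sub>R e - x) = h e * (\<Prod>r\<in>#M. t - r)))"

definition eigs :: "nat \<Rightarrow> (real^'n \<Rightarrow> real) \<Rightarrow> real^'n \<Rightarrow> real^'n \<Rightarrow> real multiset" where
  "eigs d h e x = (THE M. size M = d \<and>
        (\<forall>t. h (t *\<^sub>R e - x) = h e * (\<Prod>r\<in>#M. t - r)))"

definition hcone :: "nat \<Rightarrow> (real^'n \<Rightarrow> real) \<Rightarrow> real^'n \<Rightarrow> (real^'n) set" where
  "hcone d h e = {x. \<forall>r\<in>#eigs d h e x. r \<ge> 0}"

definition htr :: "nat \<Rightarrow> (real^'n \<Rightarrow> real) \<Rightarrow> real^'n \<Rightarrow> real^'n \<Rightarrow> real" where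
  "htr d h e x = sum_mset (eigs d h e x)"

definition hrk :: "nat \<Rightarrow> (real^'n \<Rightarrow> real) \<Rightarrow> real^'n \<Rightarrow> real^'n \<Rightarrow> nat" where
  "hrk d h e x = size (filter_mset (\<lambda>r. r \<noteq> 0) (eigs d h e x))"

text \<open>Max of |eigenvalues|; the insertion of 0 only matters for d = 0.\<close>
definition hnorm :: "nat \<Rightarrow> (real^'n \<Rightarrow> real) \<Rightarrow> real^'n \<Rightarrow> real^'n \<Rightarrow> real" where
  "hnorm d h e x = Max (insert 0 (abs ` set_mset (eigs d h e x)))"

definition delta :: "real \<Rightarrow> nat \<Rightarrow> real" where
  "delta \<alpha> m = (1 - 1 / real m + sqrt (\<alpha> - (1 / real m) * (1 - 1 / real m))) ^ 2"

end

theory Submission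
  imports Defs "HOL-Complex_Analysis.Complex_Analysis"
    "HOL-Computational_Algebra.Fundamental_Theorem_Algebra"
begin

text \<open>
  The polynomial \<open>P(s) = h(\<Sum>\<^sub>i s\<^sub>i u\<^sub>i) / h(e)\<close> is real stable, and it is multiaffine because the \<open>u\<^sub>i\<close>
  have rank at most one. Put \<open>H(x) = \<Prod>\<^sub>l P(x\<^sub>1\<^sub>l, \<dots>, x\<^sub>m\<^sub>l)\<close> for \<open>k\<close> disjoint sets of variables and
  \<open>F(x, w) = \<Prod>\<^sub>j (1 + w\<^sub>j \<Sum>\<^sub>l \<partial>\<^sub>j\<^sub>l) H(x)\<close>. Then \<open>F\<close> is again homogeneous, multiaffine and real stable,
  and the whole argument takes place inside its hyperbolicity cone \<open>C\<close>, which is convex by Garding's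
  theorem.

  If \<open>(x, w)\<close> lies in \<open>C\<close> and \<open>w\<^sub>j = -1\<close>, then \<open>F(x, w)\<close> is the average over \<open>l\<close> of the values of \<open>F\<close> at
  the points where \<open>w\<^sub>j\<close> is set to 0 and \<open>x\<^sub>j\<^sub>l\<close> is lowered by \<open>k\<close>; so one of these values is positive and
  the corresponding point lies in \<open>C\<close>. Starting from \<open>x = (\<rho>, \<dots>, \<rho>)\<close>, \<open>w = (-1, \<dots>, -1)\<close> this
  assigns the indices to the \<open>k\<close> blocks one by one, without interlacing families, and bounds the
  eigenvalues of each block by \<open>\<rho> / k\<close>.

  That the starting point lies in \<open>C\<close> is the barrier argument of Marcus, Spielman and Srivastava. Since
  \<open>F\<close> is affine in \<open>w\<^sub>i\<close>, the barrier function \<open>\<partial>F/\<partial>w\<^sub>i / F\<close> measures how far \<open>w\<^sub>i\<close> can be lowered inside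
  \<open>C\<close>, and its convexity is just the convexity of \<open>C\<close>. The last variable needs no shift of \<open>x\<close> and its
  \<open>w\<^sub>i\<close> can be lowered beyond \<open>-1\<close>; averaging over the choice of the last variable, again by convexity,
  gives the sharp constant.
\<close>

section \<open>Convexity of hyperbolicity cones\<close>

text \<open>All roots lie in the closed left half-plane, so moving from 0 to \<open>t\<close> along
  the nonnegative real axis does not decrease the distance to any of them, hence the modulus of no
  linear factor.\<close>

lemma cmod_poly_increasing:
  fixes p :: "complex poly"
  assumes roots: "\<And>z. poly p z = 0 \<Longrightarrow> Re z \<le> 0" and t: "t \<ge> 0"
  shows "cmod (poly p 0) \<le> cmod (poly p (of_real t))"
proof -
  obtain r where r: "smult (lead_coeff p) (\<Prod>i<degree p. [:- r i, 1:]) = p"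
    by (rule complex_poly_decompose')
  have eval: "poly p s = lead_coeff p * (\<Prod>i<degree p. s - r i)" for s
    by (subst (1) r[symmetric]) (simp add: poly_prod)
  have "cmod (0 - r i) \<le> cmod (of_real t - r i)" if "i < degree p" for i
  proof -
    have "poly p (r i) = 0" using that by (auto simp: eval intro!: bexI[of _ i])
    then have "Re (r i) \<le> 0" using roots by blast
    then have "(Re (r i))\<^sup>2 \<le> (t - Re (r i))\<^sup>2"
      using t by (intro power2_le_iff_abs_le[THEN iffD2]) auto
    then show ?thesis by (simp add: cmod_def)
  qed
  then show ?thesis unfolding eval norm_mult prod_norm[symmetric]
    by (intro mult_left_mono prod_mono) auto
qed

text \<open>At degree at least 2 the quotient (p(s) - p(0)) / s is a nonconstant polynomial, so it
  tends to infinity and outgrows any linear bound on p.\<close>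

lemma linear_growth_imp_degree_le_1:
  fixes p :: "complex poly"
  assumes K: "\<And>s. s \<ge> 0 \<Longrightarrow> cmod (poly p (of_real s)) \<le> K * (1 + s)"
  shows "degree p \<le> 1"
proof (rule ccontr)
  assume deg: "\<not> degree p \<le> 1"
  obtain a b q where p: "p = pCons a (pCons b q)" by (metis pCons_cases)
  have "q \<noteq> 0" using deg p by (auto split: if_splits)
  then obtain r where r: "\<And>z. r \<le> cmod z \<Longrightarrow> 2 * \<bar>K\<bar> + cmod a + 1 \<le> cmod (poly (pCons b q) z)"
    using poly_infinity by metis
  define s where "s = max 1 r"
  have s: "s \<ge> 1" "s \<ge> r" by (auto simp: s_def)
  have "s * (2 * \<bar>K\<bar> + cmod a + 1) \<le> cmod (of_real s * poly (pCons b q) (of_real s))"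
    using r[of "of_real s"] s by (auto simp: norm_mult intro!: mult_left_mono)
  also have "of_real s * poly (pCons b q) (of_real s) = poly p (of_real s) - a"
    by (simp add: p)
  also have "cmod \<dots> \<le> K * (1 + s) + cmod a"
    using K[of s] s norm_triangle_ineq4[of "poly p (of_real s)" a] by simp
  also have "K * (1 + s) \<le> \<bar>K\<bar> * (2 * s)" using s by (intro mult_mono) auto
  finally have "s * (cmod a + 1) \<le> cmod a" by (simp add: algebra_simps)
  moreover have "cmod a + 1 \<le> s * (cmod a + 1)" using mult_right_mono[of 1 s "cmod a + 1"] s by simp
  ultimately show False by simp
qed

text \<open>Continuity and polynomiality along lines stand in for multivariate polynomials, so that
  later instances may have an infinite index type while depending on finitely many coordinates only.
  Homogeneity reduces nonvanishing off the real axis to the imaginary unit.\<close>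

locale hyperbolic_function =
  fixes f :: "('i \<Rightarrow> complex) \<Rightarrow> complex" and e :: "'i \<Rightarrow> real" and D :: nat
  assumes cont: "continuous_on UNIV f"
    and line: "\<And>x v. \<exists>p. \<forall>s. f (\<lambda>i. x i + s * v i) = poly p s"
    and hom: "\<And>c x. f (\<lambda>i. c * x i) = c ^ D * f x"
    and cnj: "\<And>x. f (\<lambda>i. cnj (x i)) = cnj (f x)"
    and hyp: "\<And>x :: 'i \<Rightarrow> real. f (\<lambda>i. of_real (x i) + \<i> * of_real (e i)) \<noteq> 0"
begin

text \<open>By hyperbolicity f (a + t e) vanishes only at negatives of eigenvalues of a, so this is
  the open cone of vectors whose eigenvalues are all positive.\<close>

definition garding_cone :: "('i \<Rightarrow> real) set" where
  "garding_cone = {a. \<forall>t\<ge>0. f (\<lambda>i. of_real (a i + t * e i)) \<noteq> 0}"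

lemma cont_compose:
  assumes "\<And>i. continuous_on S (\<lambda>x. g x i)"
  shows "continuous_on S (\<lambda>x. f (g x))"
  by (rule continuous_on_compose2[OF cont])
     (auto intro: continuous_on_coordinatewise_then_product assms)

lemma line_holomorphic: "(\<lambda>s. f (\<lambda>i. x i + s * v i)) holomorphic_on S"
proof -
  obtain p where "\<forall>s. f (\<lambda>i. x i + s * v i) = poly p s" using line by blast
  then show ?thesis by (simp add: poly_holomorphic_on)
qed

lemma hom_nonzeroI: "c \<noteq> 0 \<Longrightarrow> f x \<noteq> 0 \<Longrightarrow> f (\<lambda>i. c * x i) \<noteq> 0"
  by (simp add: hom)

lemma hom_nonzeroD: "f (\<lambda>i. c * x i) \<noteq> 0 \<Longrightarrow> f x \<noteq> 0"
  by (simp add: hom)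

lemma nonzero_upper:
  assumes "Im s \<noteq> 0"
  shows "f (\<lambda>i. of_real (x i) + s * of_real (e i)) \<noteq> 0"
proof -
  have eq: "(\<lambda>i. of_real (x i) + s * of_real (e i)) =
      (\<lambda>i. of_real (Im s) * (of_real ((x i + Re s * e i) / Im s) + \<i> * of_real (e i)))"
    using assms by (intro ext) (simp add: complex_eq_iff field_simps)
  show ?thesis unfolding eq using assms by (intro hom_nonzeroI hyp) simp
qed

lemma base_nonzero: "f (\<lambda>i. of_real (e i)) \<noteq> 0"
  using hyp[of "\<lambda>_. 0"] hom_nonzeroD[of \<i> "\<lambda>i. of_real (e i)"] by simp

text \<open>A homotopy argument: the direction is deformed from \<open>e\<close> to
  \<open>b\<close>. Zeros s in the closed upper half-plane are absent at the start, cannot enter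
  through the real axis by \<open>real\<close> or from infinity by \<open>path\<close>, and cannot
  appear in the interior by Hurwitz.\<close>

lemma garding_step:
  assumes path: "\<And>\<theta>. 0 \<le> \<theta> \<Longrightarrow> \<theta> \<le> 1 \<Longrightarrow> f (\<lambda>i. of_real ((1 - \<theta>) * e i + \<theta> * b i)) \<noteq> 0"
    and real: "\<And>\<theta> r :: real. 0 \<le> \<theta> \<Longrightarrow> \<theta> \<le> 1 \<Longrightarrow>
      f (\<lambda>i. z i + of_real r * of_real ((1 - \<theta>) * e i + \<theta> * b i)) \<noteq> 0"
    and start: "\<And>s. Im s \<ge> 0 \<Longrightarrow> f (\<lambda>i. z i + s * of_real (e i)) \<noteq> 0"
    and s: "Im s \<ge> 0"
  shows "f (\<lambda>i. z i + s * of_real (b i)) \<noteq> 0"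
proof
  assume zero: "f (\<lambda>i. z i + s * of_real (b i)) = 0"
  define c where "c \<theta> i = complex_of_real ((1 - \<theta>) * e i + \<theta> * b i)" for \<theta> i
  define Q where "Q \<theta> s = f (\<lambda>i. z i + s * c \<theta> i)" for \<theta> s
  \<comment> \<open>\<open>K\<close> is \<open>Q\<close> read near infinity: zeros of
    \<open>Q\<close> at large s are zeros of \<open>K\<close> near 0, and \<open>path\<close> makes
    \<open>K\<close> nonzero at 0.\<close>
  define K where "K \<theta> \<sigma> = f (\<lambda>i. \<sigma> * z i + c \<theta> i)" for \<theta> \<sigma>
  have contc[continuous_intros]: "continuous_on S (\<lambda>x. c (g x) i)" if "continuous_on S g"
    for S i and g :: "real \<times> complex \<Rightarrow> real"
    unfolding c_def by (intro continuous_intros that)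
  have contQ: "continuous_on UNIV (\<lambda>p. Q (fst p) (snd p))"
    unfolding Q_def by (rule cont_compose) (intro continuous_intros)
  have contK: "continuous_on UNIV (\<lambda>p. K (fst p) (snd p))"
    unfolding K_def by (rule cont_compose) (intro continuous_intros)
  have QK: "Q \<theta> s = s ^ D * K \<theta> (1 / s)" if "s \<noteq> 0" for \<theta> s
  proof -
    have "(\<lambda>i. z i + s * c \<theta> i) = (\<lambda>i. s * (1 / s * z i + c \<theta> i))"
      using that by (auto simp: field_simps)
    then show ?thesis unfolding Q_def K_def by (simp only: hom)
  qed
  have closedK: "closed {p. K (fst p) (snd p) = 0}"
    using continuous_closed_vimage[of "{0}" "\<lambda>p. K (fst p) (snd p)"] contK
    by (auto simp: vimage_def continuous_on_eq_continuous_at)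
  have closedQ: "closed {p. Q (fst p) (snd p) = 0}"
    using continuous_closed_vimage[of "{0}" "\<lambda>p. Q (fst p) (snd p)"] contQ
    by (auto simp: vimage_def continuous_on_eq_continuous_at)
  obtain r where r: "r > 0" "\<And>\<theta> \<sigma>. 0 \<le> \<theta> \<Longrightarrow> \<theta> \<le> 1 \<Longrightarrow> cmod \<sigma> < r \<Longrightarrow> K \<theta> \<sigma> \<noteq> 0"
  proof -
    define Z where "Z = ({0..1} \<times> cball 0 1) \<inter> {p. K (fst p) (snd p) = 0}"
    have cZ: "compact Z" unfolding Z_def
      using closedK by (intro compact_Int_closed compact_Times) auto
    show thesis
    proof (cases "Z = {}")
      case True
      then show thesis by (intro that[of 1]) (force simp: Z_def)+
    next
      case False
      have "continuous_on Z (\<lambda>p. cmod (snd p))" by (intro continuous_intros)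
      then obtain p where p: "p \<in> Z" "\<And>q. q \<in> Z \<Longrightarrow> cmod (snd p) \<le> cmod (snd q)"
        using continuous_attains_inf[OF cZ False] by blast
      have "snd p \<noteq> 0"
      proof
        assume "snd p = 0"
        then show False using p(1) path[of "fst p"] by (auto simp: Z_def K_def c_def)
      qed
      show thesis
      proof (rule that[of "min 1 (cmod (snd p))"])
        show "min 1 (cmod (snd p)) > 0" using \<open>snd p \<noteq> 0\<close> by simp
        fix \<theta> \<sigma> assume h: "(0::real) \<le> \<theta>" "\<theta> \<le> 1" "cmod \<sigma> < min 1 (cmod (snd p))"
        show "K \<theta> \<sigma> \<noteq> 0"
        proof
          assume "K \<theta> \<sigma> = 0"
          then have "(\<theta>, \<sigma>) \<in> Z" using h by (simp add: Z_def)
          then show False using p(2) h by fastforce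
        qed
      qed
    qed
  qed
  have Qlarge: "Q \<theta> s \<noteq> 0" if "0 \<le> \<theta>" "\<theta> \<le> 1" "cmod s > 1 / r" for \<theta> s
  proof -
    have "cmod s > 0" using that r(1) by (meson less_trans zero_less_divide_1_iff)
    then have "s \<noteq> 0" "cmod (1 / s) < r"
      using that r(1) by (auto simp: norm_divide field_simps)
    then show ?thesis using QK r(2) that by simp
  qed
  \<comment> \<open>By \<open>Qlarge\<close> this compact set holds every zero in the closed upper
    half-plane; its point with least \<theta> is the first time a zero appears.\<close>
  define Z where "Z = ({0..1} \<times> (cball 0 (1 / r) \<inter> {s. Im s \<ge> 0})) \<inter> {p. Q (fst p) (snd p) = 0}"
  have "compact Z" unfolding Z_def
    using closedQ by (intro compact_Int_closed compact_Times compact_cball closed_halfspace_Im_ge) auto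
  moreover have Zin: "(\<theta>, s) \<in> Z" if "0 \<le> \<theta>" "\<theta> \<le> 1" "Im s \<ge> 0" "Q \<theta> s = 0" for \<theta> s
    using that Qlarge[of \<theta> s] by (force simp: Z_def)
  moreover have "(1, s) \<in> Z" using zero s by (intro Zin) (auto simp: Q_def c_def)
  ultimately obtain p where p: "p \<in> Z" "\<And>q. q \<in> Z \<Longrightarrow> fst p \<le> fst q"
    using continuous_attains_inf[of Z fst] by (force intro: continuous_intros)
  obtain \<theta>0 s0 where ps: "p = (\<theta>0, s0)" by (cases p)
  have p0: "0 \<le> \<theta>0" "\<theta>0 \<le> 1" "Im s0 \<ge> 0" "Q \<theta>0 s0 = 0"
    using p(1) by (auto simp: Z_def ps)
  have "\<theta>0 \<noteq> 0" using p0 start[of s0] by (auto simp: Q_def c_def)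
  have "Im s0 \<noteq> 0"
  proof
    assume "Im s0 = 0"
    then have "s0 = of_real (Re s0)" by (simp add: complex_eq_iff)
    then show False using p0 real[of \<theta>0 "Re s0"] by (simp add: Q_def c_def)
  qed
  define t where "t n = \<theta>0 * (1 - 1 / real (Suc n))" for n
  have t: "0 \<le> t n" "t n < \<theta>0" for n
    using p0 \<open>\<theta>0 \<noteq> 0\<close> by (auto simp: t_def field_simps)
  have tlim: "t \<longlonglongrightarrow> \<theta>0"
  proof -
    have "(\<lambda>n. \<theta>0 * (1 - inverse (real (Suc n)))) \<longlonglongrightarrow> \<theta>0 * (1 - 0)"
      by (intro tendsto_intros LIMSEQ_inverse_real_of_nat)
    then show ?thesis by (simp add: t_def[abs_def] inverse_eq_divide)
  qed
  define U where "U = {s. Im s > 0}"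
  \<comment> \<open>Parameters below \<open>\<theta>0\<close> give no zero in the open half-plane,
    so by Hurwitz the limit has none either; it is not identically zero because at s = 0 it takes
    the nonzero value of \<open>f\<close> at \<open>z\<close>.\<close>
  have "Q \<theta>0 s0 \<noteq> 0"
  proof (rule Hurwitz_no_zeros[of U "\<lambda>n. Q (t n)" "Q \<theta>0"])
    show "open U" unfolding U_def by (rule open_halfspace_Im_gt)
    show "connected U" unfolding U_def by (intro convex_connected convex_halfspace_Im_gt)
    show "Q (t n) holomorphic_on U" for n unfolding Q_def by (rule line_holomorphic)
    show "Q \<theta>0 holomorphic_on U" unfolding Q_def by (rule line_holomorphic)
    show "s0 \<in> U" using p0 \<open>Im s0 \<noteq> 0\<close> by (simp add: U_def)
    show "Q (t n) s \<noteq> 0" if "s \<in> U" for n s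
    proof
      assume "Q (t n) s = 0"
      then have "(t n, s) \<in> Z" using that t[of n] p0 by (intro Zin) (auto simp: U_def)
      then show False using p(2) t[of n] by (force simp: ps)
    qed
    show "\<not> Q \<theta>0 constant_on U"
    proof
      assume "Q \<theta>0 constant_on U"
      then have z: "Q \<theta>0 s = 0" if "s \<in> U" for s
        using that \<open>s0 \<in> U\<close> p0(4) by (auto simp: constant_on_def)
      obtain P where P: "\<And>s. Q \<theta>0 s = poly P s"
        using line[of z "c \<theta>0"] unfolding Q_def by blast
      have "infinite U" using \<open>open U\<close> \<open>s0 \<in> U\<close> by (metis emptyE finite_imp_not_open)
      then have "P = 0" using z P
        by (metis (mono_tags, lifting) infinite_super mem_Collect_eq poly_roots_finite subsetI)
      then have "Q \<theta>0 0 = 0" using P by simp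
      then show False using real[of 0 0] by (simp add: Q_def)
    qed
    show "uniform_limit L (\<lambda>n. Q (t n)) (Q \<theta>0) sequentially" if "compact L" "L \<subseteq> U" for L
    proof (rule uniform_limitI)
      fix \<epsilon> :: real assume "\<epsilon> > 0"
      then have half: "0 < \<epsilon> / 2" by simp
      have cQ: "continuous_on (UNIV \<times> L) (\<lambda>p. Q (fst p) (snd p))"
        by (rule continuous_on_subset[OF contQ]) simp
      obtain X0 where X0: "\<theta>0 \<in> X0" "open X0"
          "\<forall>x\<in>X0 \<inter> UNIV. \<forall>t\<in>L. dist (Q (fst (x, t)) (snd (x, t))) (Q (fst (\<theta>0, t)) (snd (\<theta>0, t))) \<le> \<epsilon> / 2"
        by (rule continuous_on_prod_compactE[OF cQ \<open>compact L\<close> UNIV_I half])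
      have "\<forall>\<^sub>F n in sequentially. t n \<in> X0"
        using topological_tendstoD[OF tlim X0(2,1)] .
      then show "\<forall>\<^sub>F n in sequentially. \<forall>x\<in>L. dist (Q (t n) x) (Q \<theta>0 x) < \<epsilon>"
        by eventually_elim (use X0(3) \<open>\<epsilon> > 0\<close> in force)
    qed
  qed
  then show False using p0 by simp
qed


section \<open>Openness and convexity of the cone\<close>

lemma cone_scale: "a \<in> garding_cone \<Longrightarrow> c > 0 \<Longrightarrow> (\<lambda>i. c * a i) \<in> garding_cone"
  unfolding garding_cone_def
proof safe
  fix t :: real
  assume a: "\<forall>t\<ge>0. f (\<lambda>i. of_real (a i + t * e i)) \<noteq> 0" and c: "c > 0" and t: "t \<ge> 0"
    and z: "f (\<lambda>i. of_real (c * a i + t * e i)) = 0"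
  have eq: "(\<lambda>i. complex_of_real (c * a i + t * e i)) = (\<lambda>i. of_real c * of_real (a i + t / c * e i))"
    using c by (auto simp: field_simps simp flip: of_real_mult)
  have "f (\<lambda>i. of_real c * of_real (a i + t / c * e i)) \<noteq> 0"
  proof (rule hom_nonzeroI)
    have "t / c \<ge> 0" using c t by simp
    then show "f (\<lambda>i. of_real (a i + t / c * e i)) \<noteq> 0" using a by blast
  qed (use c in simp)
  then show False using z eq by simp
qed

lemma cone_add_base: "a \<in> garding_cone \<Longrightarrow> t \<ge> 0 \<Longrightarrow> (\<lambda>i. a i + t * e i) \<in> garding_cone"
  unfolding garding_cone_def
proof safe
  fix s :: real
  assume a: "\<forall>t\<ge>0. f (\<lambda>i. of_real (a i + t * e i)) \<noteq> 0" and t: "t \<ge> 0" and s: "s \<ge> 0"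
    and z: "f (\<lambda>i. of_real (a i + t * e i + s * e i)) = 0"
  show False using a[rule_format, of "t + s"] z s t by (simp add: algebra_simps)
qed

lemma cone_nonzero: "a \<in> garding_cone \<Longrightarrow> f (\<lambda>i. of_real (a i)) \<noteq> 0"
  unfolding garding_cone_def by (auto dest: spec[of _ 0])

text \<open>\<open>f\<close> is nonzero near \<open>e\<close>, and dividing
  \<open>e + \<eta> y + t e\<close> by \<open>1 + t\<close> gives
  \<open>e + \<eta> / (1 + t) y\<close>, which is no farther from \<open>e\<close>.\<close>

lemma cone_absorb:
  fixes y :: "'i \<Rightarrow> real"
  obtains \<eta> where "\<eta> > 0" "(\<lambda>i. e i + \<eta> * y i) \<in> garding_cone"
proof -
  define g where "g t = f (\<lambda>i. of_real (e i + t * y i))" for t :: real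
  have "continuous_on UNIV g" unfolding g_def by (rule cont_compose) (intro continuous_intros)
  then have "isCont g 0" by (simp add: continuous_on_eq_continuous_at)
  moreover have "g 0 \<noteq> 0" using base_nonzero by (simp add: g_def)
  ultimately obtain d where d: "d > 0" "\<And>t. \<bar>t\<bar> < d \<Longrightarrow> g t \<noteq> 0"
    using continuous_at_avoid[of 0 g 0] by (auto simp: dist_real_def)
  have "(\<lambda>i. e i + d / 2 * y i) \<in> garding_cone" unfolding garding_cone_def
  proof safe
    fix t :: real assume t: "t \<ge> 0" and z: "f (\<lambda>i. of_real (e i + d / 2 * y i + t * e i)) = 0"
    have "(\<lambda>i. complex_of_real (e i + d / 2 * y i + t * e i)) =
        (\<lambda>i. of_real (1 + t) * of_real (e i + d / (2 * (1 + t)) * y i))"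
    proof
      fix i
      have "e i + d / 2 * y i + t * e i = (1 + t) * (e i + d / (2 * (1 + t)) * y i)"
        using t by (simp add: divide_simps) (simp add: algebra_simps)
      then show "complex_of_real (e i + d / 2 * y i + t * e i) =
          of_real (1 + t) * of_real (e i + d / (2 * (1 + t)) * y i)"
        by (simp only: of_real_mult)
    qed
    then have "g (d / (2 * (1 + t))) = 0"
      using z t unfolding g_def by (simp only: hom) (simp del: of_real_add of_real_mult)
    moreover have "\<bar>d / (2 * (1 + t))\<bar> < d"
    proof -
      have "d / (2 * (1 + t)) \<le> d / 2" using d t by (intro divide_left_mono) auto
      moreover have "0 \<le> d / (2 * (1 + t))" using d t by simp
      ultimately show ?thesis using d(1) by linarith
    qed
    ultimately show False using d by blast
  qed
  then show thesis using that[of "d / 2"] d by simp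
qed

lemma cone_base: "e \<in> garding_cone"
  using cone_absorb[of "\<lambda>_. 0"] by auto

lemma cone_open:
  assumes "a \<in> garding_cone"
  obtains \<gamma> where "\<gamma> > 0" "(\<lambda>i. a i - \<gamma> * e i) \<in> garding_cone"
proof -
  define g where "g t = f (\<lambda>i. of_real (a i + t * e i))" for t :: real
  have "continuous_on UNIV g" unfolding g_def by (rule cont_compose) (intro continuous_intros)
  then have "isCont g 0" by (simp add: continuous_on_eq_continuous_at)
  moreover have "g 0 \<noteq> 0" using cone_nonzero[OF assms] by (simp add: g_def)
  ultimately obtain d where d: "d > 0" "\<And>t. \<bar>t\<bar> < d \<Longrightarrow> g t \<noteq> 0"
    using continuous_at_avoid[of 0 g 0] by (auto simp: dist_real_def)
  have "(\<lambda>i. a i - d / 2 * e i) \<in> garding_cone" unfolding garding_cone_def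
  proof safe
    fix t :: real assume t: "t \<ge> 0" and z: "f (\<lambda>i. of_real (a i - d / 2 * e i + t * e i)) = 0"
    then have g: "g (t - d / 2) = 0" by (simp add: g_def algebra_simps)
    show False
    proof (cases "t \<ge> d / 2")
      case True
      then show False using g assms unfolding garding_cone_def g_def mem_Collect_eq
        by (metis diff_ge_0_iff_ge)
    next
      case False
      then show False using g d(2)[of "t - d / 2"] d(1) t by auto
    qed
  qed
  then show thesis using that[of "d / 2"] d by simp
qed

text \<open>Dividing by \<theta> moves the point onto the ray \<open>a + t e\<close> with
  \<open>t = (1 - \<theta>) / \<theta>\<close>.\<close>

lemma cone_segment:
  assumes "a \<in> garding_cone" "0 \<le> \<theta>" "\<theta> \<le> 1"
  shows "f (\<lambda>i. of_real ((1 - \<theta>) * e i + \<theta> * a i)) \<noteq> 0"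
proof (cases "\<theta> = 0")
  case True
  then show ?thesis using base_nonzero by simp
next
  case False
  then have "(\<lambda>i. complex_of_real ((1 - \<theta>) * e i + \<theta> * a i)) =
      (\<lambda>i. of_real \<theta> * of_real (a i + (1 - \<theta>) / \<theta> * e i))"
    by (intro ext) (simp add: field_simps flip: of_real_mult of_real_add)
  moreover have "f (\<lambda>i. of_real (a i + (1 - \<theta>) / \<theta> * e i)) \<noteq> 0"
  proof -
    have "(1 - \<theta>) / \<theta> \<ge> 0" using assms by simp
    then show ?thesis using assms(1) unfolding garding_cone_def by blast
  qed
  ultimately show ?thesis using False by (simp only: hom) (simp del: of_real_add of_real_mult)
qed

text \<open>Split \<open>a\<close> into a cone element and a small multiple
  \<open>\<gamma> e\<close>. The part \<i> \<gamma> e keeps all real shifts off the zero set, so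
  \<open>garding_step\<close> can turn the direction \<open>e\<close> into the remaining cone
  element.\<close>

lemma cone_hyperbolic:
  fixes x :: "'i \<Rightarrow> real"
  assumes "a \<in> garding_cone"
  shows "f (\<lambda>i. of_real (x i) + \<i> * of_real (a i)) \<noteq> 0"
proof -
  obtain \<gamma> where \<gamma>: "\<gamma> > 0" "(\<lambda>i. a i - \<gamma> * e i) \<in> garding_cone" using cone_open assms by blast
  let ?a = "\<lambda>i. a i - \<gamma> * e i"
  have up: "f (\<lambda>i. of_real (x i) + s * of_real (e i)) \<noteq> 0" if "Im s > 0" for s x
    using nonzero_upper that by simp
  have "f (\<lambda>i. (of_real (x i) + \<i> * of_real \<gamma> * of_real (e i)) + \<i> * of_real (?a i)) \<noteq> 0"
  proof (rule garding_step)
    fix \<theta> r :: real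
    have "(\<lambda>i. of_real (x i) + \<i> * of_real \<gamma> * of_real (e i) +
        of_real r * of_real ((1 - \<theta>) * e i + \<theta> * ?a i)) =
      (\<lambda>i. of_real (x i + r * ((1 - \<theta>) * e i + \<theta> * ?a i)) + (\<i> * of_real \<gamma>) * of_real (e i))"
      by (auto simp: algebra_simps)
    moreover have "f (\<lambda>i. of_real (x i + r * ((1 - \<theta>) * e i + \<theta> * ?a i)) +
        (\<i> * of_real \<gamma>) * of_real (e i)) \<noteq> 0"
      by (rule up) (use \<gamma>(1) in simp)
    ultimately show "f (\<lambda>i. of_real (x i) + \<i> * of_real \<gamma> * of_real (e i) +
        of_real r * of_real ((1 - \<theta>) * e i + \<theta> * ?a i)) \<noteq> 0"
      by (simp only: not_False_eq_True)
  next
    fix s :: complex assume "Im s \<ge> 0"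
    then have "f (\<lambda>i. of_real (x i) + (\<i> * of_real \<gamma> + s) * of_real (e i)) \<noteq> 0"
      using up[of "\<i> * of_real \<gamma> + s"] \<gamma>(1) by simp
    then show "f (\<lambda>i. of_real (x i) + \<i> * of_real \<gamma> * of_real (e i) + s * of_real (e i)) \<noteq> 0"
      by (simp add: algebra_simps)
  qed (use cone_segment[OF \<gamma>(2)] in auto)
  then show ?thesis by (simp add: algebra_simps)
qed

text \<open>\<open>garding_step\<close> with base point \<i> a: real shifts are excluded by
  hyperbolicity in direction \<open>a\<close>, and the start by \<open>a + t e\<close> lying in the
  cone. At s = \<i> it yields the value at \<i> (a + b).\<close>

lemma cone_add_nonzero:
  assumes a: "a \<in> garding_cone" and b: "b \<in> garding_cone"
  shows "f (\<lambda>i. of_real (a i + b i)) \<noteq> 0"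
proof -
  have "f (\<lambda>i. \<i> * of_real (a i) + \<i> * of_real (b i)) \<noteq> 0"
  proof (rule garding_step)
    fix \<theta> r :: real
    have "(\<lambda>i. \<i> * of_real (a i) + of_real r * of_real ((1 - \<theta>) * e i + \<theta> * b i)) =
      (\<lambda>i. of_real (r * ((1 - \<theta>) * e i + \<theta> * b i)) + \<i> * of_real (a i))"
      by (auto simp: algebra_simps)
    then show "f (\<lambda>i. \<i> * of_real (a i) + of_real r * of_real ((1 - \<theta>) * e i + \<theta> * b i)) \<noteq> 0"
      using cone_hyperbolic[OF a, of "\<lambda>i. r * ((1 - \<theta>) * e i + \<theta> * b i)"]
      by (simp only: not_False_eq_True)
  next
    fix s :: complex assume "Im s \<ge> 0"
    then have "(\<lambda>i. a i + Im s * e i) \<in> garding_cone" using cone_add_base[OF a] by blast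
    moreover have "(\<lambda>i. \<i> * of_real (a i) + s * of_real (e i)) =
        (\<lambda>i. of_real (Re s * e i) + \<i> * of_real (a i + Im s * e i))"
      by (auto simp: complex_eq_iff)
    ultimately show "f (\<lambda>i. \<i> * of_real (a i) + s * of_real (e i)) \<noteq> 0"
      using cone_hyperbolic by metis
  qed (use cone_segment[OF b] in auto)
  then have "f (\<lambda>i. \<i> * of_real (a i + b i)) \<noteq> 0" by (simp add: distrib_left)
  then show ?thesis by (auto simp only: hom mult_zero_right)
qed

lemma cone_add:
  assumes a: "a \<in> garding_cone" and b: "b \<in> garding_cone"
  shows "(\<lambda>i. a i + b i) \<in> garding_cone"
  unfolding garding_cone_def
proof safe
  fix t :: real assume "t \<ge> 0" and z: "f (\<lambda>i. of_real (a i + b i + t * e i)) = 0"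
  then have "(\<lambda>i. b i + t * e i) \<in> garding_cone" using cone_add_base b by blast
  then have "f (\<lambda>i. of_real (a i + (b i + t * e i))) \<noteq> 0" using cone_add_nonzero a by blast
  then show False using z by (simp add: add.assoc)
qed

text \<open>The hypothesis on \<open>u\<close> encodes the closed cone. By openness a slack
  \<open>\<gamma> e\<close> can be taken from \<open>a\<close> and lent to \<open>u\<close>.\<close>

lemma cone_add_closure:
  assumes a: "a \<in> garding_cone" and u: "\<And>\<eta>. \<eta> > 0 \<Longrightarrow> (\<lambda>i. u i + \<eta> * e i) \<in> garding_cone"
  shows "(\<lambda>i. a i + u i) \<in> garding_cone"
proof -
  obtain \<gamma> where \<gamma>: "\<gamma> > 0" "(\<lambda>i. a i - \<gamma> * e i) \<in> garding_cone" using cone_open a by blast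
  from cone_add[OF this(2) u[OF this(1)]] show ?thesis by (simp add: algebra_simps)
qed

section \<open>Growth and affinity along cone directions\<close>

lemma cone_right_half_plane:
  assumes a: "a \<in> garding_cone" and v: "v \<in> garding_cone" and s: "Re s \<ge> 0"
  shows "f (\<lambda>i. of_real (a i) + s * of_real (v i)) \<noteq> 0"
proof -
  have B: "(\<lambda>i. a i + Re s * v i) \<in> garding_cone"
  proof (cases "Re s = 0")
    case False
    then show ?thesis using cone_add[OF a cone_scale[OF v, of "Re s"]] s by simp
  qed (use a in simp)
  have eq: "(\<lambda>i. of_real (a i) + s * of_real (v i)) =
      (\<lambda>i. (- \<i>) * (of_real (- Im s * v i) + \<i> * of_real (a i + Re s * v i)))"
    by (auto simp: complex_eq_iff)
  show ?thesis unfolding eq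
    by (rule hom_nonzeroI) (simp, rule cone_hyperbolic[OF B])
qed

lemma cone_increasing:
  assumes a: "a \<in> garding_cone" and v: "v \<in> garding_cone"
  shows "cmod (f (\<lambda>i. of_real (a i))) \<le> cmod (f (\<lambda>i. of_real (a i + v i)))"
proof -
  obtain p where p: "\<And>s. f (\<lambda>i. of_real (a i) + s * of_real (v i)) = poly p s"
    using line[of "\<lambda>i. of_real (a i)" "\<lambda>i. of_real (v i)"] by blast
  have "Re z \<le> 0" if "poly p z = 0" for z
    using that cone_right_half_plane[OF a v, of z] p by force
  then have "cmod (poly p 0) \<le> cmod (poly p (of_real 1))"
    by (rule cmod_poly_increasing) simp_all
  then show ?thesis using p[of 0] p[of 1] by simp
qed

text \<open>The cone is Zariski dense: the line from any real point in direction \<open>e\<close> is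
  eventually inside it, and a complex point lies on the complex line through its real part in the
  direction of its imaginary part.\<close>

lemma vanish_on_cone:
  assumes line': "\<And>x v. \<exists>p. \<forall>s. g (\<lambda>i. x i + s * v i) = poly p s"
    and g: "\<And>a. a \<in> garding_cone \<Longrightarrow> g (\<lambda>i. complex_of_real (a i)) = 0"
  shows "g z = 0"
proof -
  have inf: "infinite (of_real ` {T..} :: complex set)" for T :: real
    by (simp add: finite_image_iff inj_on_def infinite_Ici)
  have poly0: "p = 0" if "\<And>t. t \<ge> T \<Longrightarrow> poly p (complex_of_real t) = 0" for p T
    using that inf[of T] poly_roots_finite[of p] infinite_super[of "of_real ` {T..}" "{x. poly p x = 0}"]
    by auto
  have re: "g (\<lambda>i. complex_of_real (x i)) = 0" for x
  proof -
    obtain p where p: "\<And>s. g (\<lambda>i. of_real (x i) + s * of_real (e i)) = poly p s"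
      using line'[of "\<lambda>i. of_real (x i)" "\<lambda>i. of_real (e i)"] by blast
    obtain \<eta> where \<eta>: "\<eta> > 0" "(\<lambda>i. e i + \<eta> * x i) \<in> garding_cone" using cone_absorb by blast
    have "p = 0"
    proof (rule poly0[of "1 / \<eta>"])
      fix t assume t: "t \<ge> 1 / \<eta>"
      have "(\<lambda>i. 1 / \<eta> * (e i + \<eta> * x i) + (t - 1 / \<eta>) * e i) \<in> garding_cone"
        using t \<eta> by (intro cone_add_base cone_scale) auto
      moreover have "(\<lambda>i. 1 / \<eta> * (e i + \<eta> * x i) + (t - 1 / \<eta>) * e i) = (\<lambda>i. x i + t * e i)"
        using \<eta>(1) by (auto simp: field_simps)
      ultimately show "poly p (of_real t) = 0" using g p[of "of_real t"] by fastforce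
    qed
    then show ?thesis using p[of 0] by simp
  qed
  obtain p where p: "\<And>s. g (\<lambda>i. of_real (Re (z i)) + s * of_real (Im (z i))) = poly p s"
    using line'[of "\<lambda>i. of_real (Re (z i))" "\<lambda>i. of_real (Im (z i))"] by blast
  have "p = 0"
  proof (rule poly0[of 0])
    fix t show "poly p (of_real t) = 0"
      using re[of "\<lambda>i. Re (z i) + t * Im (z i)"] by (simp flip: p)
  qed
  then show ?thesis using p[of \<i>] by (simp add: complex_eq[symmetric])
qed

text \<open>Linear growth along \<open>u\<close> from the single point \<open>e\<close> transfers to
  every cone point \<open>y\<close>, since some multiple \<open>\<eta> y\<close> lies below
  \<open>e\<close> in the cone order and \<open>cone_increasing\<close> applies. So \<open>f\<close>
  has degree at most 1 along \<open>u\<close> at cone points, and \<open>vanish_on_cone\<close>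
  extends the resulting identity to all points.\<close>

lemma affine_along_rank_one:
  assumes u: "\<And>\<eta>. \<eta> > 0 \<Longrightarrow> (\<lambda>i. u i + \<eta> * e i) \<in> garding_cone"
    and K: "\<And>s. s \<ge> 0 \<Longrightarrow> cmod (f (\<lambda>i. of_real (e i + s * u i))) \<le> K * (1 + s)"
  shows "f (\<lambda>i. z i + s * of_real (u i)) = f z + s * (f (\<lambda>i. z i + of_real (u i)) - f z)"
proof -
  define g where "g z = f (\<lambda>i. z i + s * of_real (u i)) - f z - s * (f (\<lambda>i. z i + of_real (u i)) - f z)" for z
  have "g z = 0"
  proof (rule vanish_on_cone[of g])
    fix x v :: "'i \<Rightarrow> complex"
    obtain p1 where p1: "\<And>t. f (\<lambda>i. (x i + s * of_real (u i)) + t * v i) = poly p1 t"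
      using line[of "\<lambda>i. x i + s * of_real (u i)" v] by blast
    obtain p2 where p2: "\<And>t. f (\<lambda>i. x i + t * v i) = poly p2 t" using line[of x v] by blast
    obtain p3 where p3: "\<And>t. f (\<lambda>i. (x i + of_real (u i)) + t * v i) = poly p3 t"
      using line[of "\<lambda>i. x i + of_real (u i)" v] by blast
    have "g (\<lambda>i. x i + t * v i) = poly (p1 - p2 - smult s (p3 - p2)) t" for t
      unfolding g_def using p1[of t] p2[of t] p3[of t] by (simp add: add_ac)
    then show "\<exists>p. \<forall>t. g (\<lambda>i. x i + t * v i) = poly p t" by blast
  next
    fix y assume y: "y \<in> garding_cone"
    obtain p where p: "\<And>t. f (\<lambda>i. of_real (y i) + t * of_real (u i)) = poly p t"
      using line[of "\<lambda>i. of_real (y i)" "\<lambda>i. of_real (u i)"] by blast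
    obtain \<eta> where \<eta>: "\<eta> > 0" "(\<lambda>i. e i + \<eta> * (- y i)) \<in> garding_cone"
      by (rule cone_absorb[of "\<lambda>i. - y i"])
    have K0: "K \<ge> 0" using order_trans[OF norm_ge_zero K[of 0]] by simp
    have "degree p \<le> 1"
    proof (rule linear_growth_imp_degree_le_1)
      fix s :: real assume s: "s \<ge> 0"
      have "\<exists>w. w \<in> garding_cone \<and> w = (\<lambda>i. \<eta> * y i + s * \<eta> * u i)"
      proof (cases "s = 0")
        case True then show ?thesis using cone_scale[OF y \<eta>(1)] by simp
      next
        case False
        have "(\<lambda>i. \<eta> * y i + s * \<eta> * u i) \<in> garding_cone"
        proof (rule cone_add_closure[OF cone_scale[OF y \<eta>(1)]])
          fix \<delta> :: real assume "\<delta> > 0"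
          then have "(\<lambda>i. (s * \<eta>) * (u i + \<delta> / (s * \<eta>) * e i)) \<in> garding_cone"
            using False s \<eta>(1) by (intro cone_scale u) auto
          moreover have "(s * \<eta>) * (u i + \<delta> / (s * \<eta>) * e i) = s * \<eta> * u i + \<delta> * e i" for i
            using False \<eta>(1) by (simp add: field_simps)
          ultimately show "(\<lambda>i. s * \<eta> * u i + \<delta> * e i) \<in> garding_cone" by simp
        qed
        then show ?thesis by blast
      qed
      then have w: "(\<lambda>i. \<eta> * y i + s * \<eta> * u i) \<in> garding_cone" by blast
      have "\<eta> ^ D * cmod (poly p (of_real s)) =
          cmod (f (\<lambda>i. of_real \<eta> * (of_real (y i) + of_real s * of_real (u i))))"
        using \<eta>(1) by (simp only: hom norm_mult p) (simp add: norm_power)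
      also have "\<dots> = cmod (f (\<lambda>i. of_real (\<eta> * y i + s * \<eta> * u i)))"
        by (simp add: algebra_simps)
      also have "\<dots> \<le> cmod (f (\<lambda>i. of_real (\<eta> * y i + s * \<eta> * u i + (e i + \<eta> * (- y i)))))"
        by (rule cone_increasing[OF w \<eta>(2)])
      also have "\<dots> = cmod (f (\<lambda>i. of_real (e i + (s * \<eta>) * u i)))" by (simp add: algebra_simps)
      also have "\<dots> \<le> K * (1 + s * \<eta>)" by (rule K) (use s \<eta>(1) in simp)
      also have "\<dots> \<le> K * ((1 + \<eta>) * (1 + s))"
        using s \<eta>(1) K0 by (intro mult_left_mono) (auto simp: algebra_simps)
      finally show "cmod (poly p (of_real s)) \<le> (K * (1 + \<eta>) / \<eta> ^ D) * (1 + s)"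
        using \<eta>(1) by (simp add: field_simps)
    qed
    then have "p = [:coeff p 0, coeff p 1:]"
      by (intro poly_eqI) (auto simp: coeff_pCons coeff_eq_0 split: nat.split)
    then obtain a b where ab: "p = [:a, b:]" by blast
    show "g (\<lambda>i. of_real (y i)) = 0"
      unfolding g_def using p[of s] p[of 0] p[of 1] by (simp add: ab)
  qed
  then show ?thesis by (simp add: g_def diff_eq_eq add.commute)
qed

end

section \<open>The barrier argument for multiaffine stable polynomials\<close>

lemma le_by_scaling:
  fixes x y :: real
  assumes "\<And>s. 0 \<le> s \<Longrightarrow> s < 1 \<Longrightarrow> s * x \<le> y"
  shows "x \<le> y"
proof (rule ccontr)
  assume "\<not> x \<le> y"
  then have xy: "y < x" by simp
  have y0: "0 \<le> y" using assms[of 0] by simp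
  then have x0: "x > 0" using xy by simp
  define r where "r = y / x"
  define s where "s = (r + 1) / 2"
  have "r < 1" "0 \<le> r" using xy x0 y0 by (simp_all add: r_def)
  then have s: "0 \<le> s" "s < 1" "r < s" by (simp_all add: s_def)
  then have "y < s * x" using x0 by (simp add: r_def pos_divide_less_eq)
  then show False using assms[OF s(1,2)] by simp
qed

text \<open>The algebra that closes \<open>barrier_step\<close>, with \<open>f\<close>,
  \<open>a\<close>, \<open>b\<close>, \<open>g\<close> the value, two partial derivatives and the
  mixed one. The bounds first force \<open>c a \<le> f\<close> and then
  \<open>c (a b - f g) \<le> (f - b) (f - c a)\<close>; there the terms \<open>c a b\<close> cancel
  and \<open>f\<close> divides out.\<close>

lemma barrier_arith:
  fixes a b c f g :: real
  assumes "c > 1" "f > 0" "a > 0" "c * b \<le> f" "f * g \<le> a * b"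
    and key: "c * a\<^sup>2 \<le> f * a - c / (c - 1) * (a * b - f * g)"
  shows "c * (a - g) \<le> f - b"
proof -
  define K where "K = a * b - f * g"
  have K: "K \<ge> 0" using assms by (simp add: K_def)
  have "c / (c - 1) * K \<le> a * (f - c * a)"
    using key by (simp add: K_def power2_eq_square algebra_simps)
  then have cK: "c * K \<le> (c - 1) * (a * (f - c * a))"
    using assms(1) by (simp add: field_simps)
  have "0 \<le> c * K" using K assms by simp
  then have "0 \<le> (c - 1) * (a * (f - c * a))" using cK by linarith
  then have fca: "0 \<le> f - c * a" using assms by (simp add: zero_le_mult_iff)
  then have "(c - 1) * (c * a) \<le> (c - 1) * f" using assms(1) by (intro mult_left_mono) auto
  then have "c * ((c - 1) * a) \<le> (c - 1) * f" by (simp add: mult.left_commute)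
  also have "\<dots> \<le> c * (f - b)" using assms by (simp add: algebra_simps)
  finally have "(c - 1) * a \<le> f - b" using assms(1) by simp
  then have "(c - 1) * a * (f - c * a) \<le> (f - b) * (f - c * a)" using fca by (rule mult_right_mono)
  then have "c * K \<le> (f - b) * (f - c * a)" using cK by (simp add: mult.assoc)
  then have "f * (c * (a - g)) \<le> f * (f - b)"
    by (simp add: K_def algebra_simps)
  then show ?thesis using assms(2) by simp
qed

text \<open>For a function affine in each variable the unit difference
  \<open>F (z(i := z i + 1)) - F z\<close> is the partial derivative; multiaffinity is stated
  through it, and \<open>dR\<close> below is the partial derivative for the same reason.\<close>

locale stable_multiaffine = hyperbolic_function F "\<lambda>_. 1" D
  for F :: "('v \<Rightarrow> complex) \<Rightarrow> complex" and D +
  assumes affine: "\<And>z i t. F (z(i := z i + t)) = F z + t * (F (z(i := z i + 1)) - F z)"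
    and stable: "\<And>z. (\<And>i. Im (z i) > 0) \<Longrightarrow> F z \<noteq> 0"
    and pos: "Re (F (\<lambda>_. 1)) > 0"
begin

definition R :: "('v \<Rightarrow> real) \<Rightarrow> real" where
  "R a = Re (F (\<lambda>i. of_real (a i)))"

definition dR :: "'v \<Rightarrow> ('v \<Rightarrow> real) \<Rightarrow> real" where
  "dR i a = R (a(i := a i + 1)) - R a"

lemma of_real_R: "F (\<lambda>i. of_real (a i)) = of_real (R a)"
  using cnj[of "\<lambda>i. of_real (a i)"] by (simp add: R_def complex_eq_iff)

lemma R_affine: "R (a(i := a i + t)) = R a + t * dR i a"
proof -
  have *: "(\<lambda>v. complex_of_real ((a(i := x)) v)) = (\<lambda>v. of_real (a v))(i := of_real x)" for x
    by auto
  show ?thesis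
    using affine[of "\<lambda>v. of_real (a v)" i "of_real t"]
    by (simp add: R_def dR_def * del: fun_upd_apply)
qed

lemma R_affine': "R (a(i := a i - t)) = R a - t * dR i a"
  using R_affine[of a i "-t"] by simp

lemma dR_affine: "i \<noteq> j \<Longrightarrow> dR i (a(j := a j + t)) = dR i a + t * (dR i (a(j := a j + 1)) - dR i a)"
proof -
  assume "i \<noteq> j"
  then have tw: "(a(j := x))(i := y) = (a(i := y))(j := x)" for x y by (rule fun_upd_twist[symmetric])
  show ?thesis using \<open>i \<noteq> j\<close>
    using R_affine[of "a(i := a i + 1)" j t] R_affine[of "a(i := a i + 1)" j 1] R_affine[of a j t] R_affine[of a j 1]
    by (simp add: dR_def tw algebra_simps)
qed

lemma cont_R:
  assumes "\<And>i. continuous_on S (\<lambda>x. g x i)"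
  shows "continuous_on S (\<lambda>x. R (g x))"
  unfolding R_def by (intro continuous_intros cont_compose assms)

text \<open>The segment to the all-ones vector avoids zeros, so the real-valued \<open>R\<close>
  keeps the sign it has there.\<close>

lemma R_pos:
  assumes "a \<in> garding_cone"
  shows "R a > 0"
proof (rule ccontr)
  assume neg: "\<not> R a > 0"
  define g where "g \<theta> = R (\<lambda>i. (1 - \<theta>) * 1 + \<theta> * a i)" for \<theta>
  have "continuous_on {0..1} g"
    unfolding g_def by (rule cont_R) (intro continuous_intros)
  moreover have "g 1 \<le> 0" "0 \<le> g 0" using neg pos by (simp_all add: g_def R_def)
  ultimately obtain \<theta> where \<theta>: "0 \<le> \<theta>" "\<theta> \<le> 1" "g \<theta> = 0" using IVT2'[of g 1 0 0] by auto
  then have "F (\<lambda>i. of_real ((1 - \<theta>) * 1 + \<theta> * a i)) = 0"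
    by (simp only: of_real_R g_def of_real_0)
  then show False using cone_segment[OF assms \<theta>(1,2)] by blast
qed

lemma orthant_nonzero:
  assumes "\<And>i. v i > 0"
  shows "F (\<lambda>i. of_real (v i)) \<noteq> 0"
  by (rule hom_nonzeroD[of \<i>], rule stable) (simp add: assms)

lemma orthant_closure:
  assumes "\<And>i. v i \<ge> 0" "\<eta> > 0"
  shows "(\<lambda>i. v i + \<eta> * 1) \<in> garding_cone"
  unfolding garding_cone_def
proof safe
  fix t :: real assume "t \<ge> 0" and z: "F (\<lambda>i. of_real (v i + \<eta> * 1 + t * 1)) = 0"
  have "F (\<lambda>i. of_real (v i + \<eta> * 1 + t * 1)) \<noteq> 0"
    by (rule orthant_nonzero) (use assms \<open>t \<ge> 0\<close> in \<open>simp add: add_nonneg_pos add_pos_nonneg\<close>)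
  then show False using z by blast
qed

text \<open>Stability makes \<open>F\<close> nonzero on the positive orthant, so nonnegative vectors
  lie in the closed cone and may be added.\<close>

lemma cone_mono:
  assumes a: "a \<in> garding_cone" and le: "\<And>i. a i \<le> b i"
  shows "b \<in> garding_cone"
  using cone_add_closure[OF a orthant_closure[of "\<lambda>i. b i - a i"]] le by simp

lemma cone_boundary:
  assumes "\<And>t. t > 0 \<Longrightarrow> (\<lambda>i. a i + t) \<in> garding_cone" "R a > 0"
  shows "a \<in> garding_cone"
  unfolding garding_cone_def
proof safe
  fix t :: real assume t: "t \<ge> 0" and z: "F (\<lambda>i. of_real (a i + t * 1)) = 0"
  show False
  proof (cases "t = 0")
    case True
    then show False using z assms(2) of_real_R[of a] by simp
  next
    case False
    then show False using z t cone_nonzero[OF assms(1)[of t]] by simp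
  qed
qed

text \<open>\<open>R\<close> is affine along a coordinate, so positivity at both ends gives
  positivity in between, and a path on which \<open>R\<close> is positive cannot cross the boundary
  of the cone. Hence the supremum of the admissible shifts is the full \<open>t\<close>.\<close>

lemma cone_down:
  assumes a: "a \<in> garding_cone" and t: "t \<ge> 0" and p: "R (a(i := a i - t)) > 0"
  shows "a(i := a i - t) \<in> garding_cone"
proof -
  define b where "b \<tau> = a(i := a i - \<tau>)" for \<tau>
  define S where "S = {\<tau>. 0 \<le> \<tau> \<and> \<tau> \<le> t \<and> b \<tau> \<in> garding_cone}"
  have pos_seg: "R (b \<tau>) > 0" if "0 \<le> \<tau>" "\<tau> \<le> t" for \<tau>
  proof (cases "dR i a \<ge> 0")
    case True
    then have "\<tau> * dR i a \<le> t * dR i a" using that by (intro mult_right_mono)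
    then show ?thesis using p by (simp add: b_def R_affine')
  next
    case False
    then have "\<tau> * dR i a \<le> 0" using that by (simp add: mult_nonneg_nonpos)
    then show ?thesis using R_pos[OF a] by (simp add: b_def R_affine')
  qed
  have "0 \<in> S" using a t by (simp add: S_def b_def)
  have bdd: "bdd_above S" by (rule bdd_aboveI[of _ t]) (simp add: S_def)
  define \<sigma> where "\<sigma> = Sup S"
  have \<sigma>: "0 \<le> \<sigma>" "\<sigma> \<le> t"
    unfolding \<sigma>_def using \<open>0 \<in> S\<close> bdd by (auto intro!: cSup_upper cSup_least simp: S_def)
  have in\<sigma>: "b \<sigma> \<in> garding_cone"
  proof (rule cone_boundary)
    fix \<epsilon> :: real assume "\<epsilon> > 0"
    then obtain \<tau> where \<tau>: "\<tau> \<in> S" "\<sigma> - \<epsilon> < \<tau>"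
      using less_cSupD[of S "\<sigma> - \<epsilon>"] \<open>0 \<in> S\<close> by (auto simp: \<sigma>_def)
    then have "b \<tau> \<in> garding_cone" by (simp add: S_def)
    then show "(\<lambda>i. b \<sigma> i + \<epsilon>) \<in> garding_cone"
      by (rule cone_mono) (use \<tau> \<open>\<epsilon> > 0\<close> in \<open>simp add: b_def\<close>)
  qed (rule pos_seg[OF \<sigma>])
  have "\<sigma> = t"
  proof (rule ccontr)
    assume "\<sigma> \<noteq> t"
    then have "\<sigma> < t" using \<sigma> by simp
    obtain \<gamma> where \<gamma>: "\<gamma> > 0" "(\<lambda>v. b \<sigma> v - \<gamma> * 1) \<in> garding_cone" by (rule cone_open[OF in\<sigma>])
    define \<tau> where "\<tau> = min t (\<sigma> + \<gamma>)"
    have "b \<tau> \<in> garding_cone"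
      by (rule cone_mono[OF \<gamma>(2)]) (use \<gamma>(1) in \<open>auto simp: b_def \<tau>_def\<close>)
    then have "\<tau> \<in> S" using \<sigma> \<gamma>(1) by (simp add: S_def \<tau>_def)
    then have "\<tau> \<le> \<sigma>" unfolding \<sigma>_def by (rule cSup_upper[OF _ bdd])
    then show False using \<open>\<sigma> < t\<close> \<gamma>(1) by (simp add: \<tau>_def split: if_splits)
  qed
  then show ?thesis using in\<sigma> by (simp add: b_def)
qed

section \<open>The ratio of R to a partial derivative as distance to the cone boundary\<close>

lemma dR_nonneg:
  assumes "a \<in> garding_cone"
  shows "dR i a \<ge> 0"
proof (rule ccontr)
  assume neg: "\<not> dR i a \<ge> 0"
  \<comment> \<open>The shift at which the affine function would reach 0, although an upward shift
    cannot leave the cone.\<close>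
  define t where "t = R a / (- dR i a)"
  have "t \<ge> 0" using neg R_pos[OF assms] by (simp add: t_def divide_nonneg_neg divide_nonpos_neg)
  then have "a(i := a i + t) \<in> garding_cone" by (intro cone_mono[OF assms]) simp
  from R_pos[OF this] have "R a + t * dR i a > 0" by (simp only: R_affine)
  then show False using neg by (simp add: t_def)
qed

text \<open>\<open>p * dR i a \<le> R a\<close> says that the boundary lies at distance at least
  \<open>p\<close> when coordinate \<open>i\<close> is lowered; the product form also covers a
  vanishing derivative. The factor \<open>s < 1\<close> keeps the point off the boundary.\<close>

lemma cone_down_ratio:
  assumes "a \<in> garding_cone" "0 \<le> s" "s < 1" "0 \<le> p" "p * dR i a \<le> R a"
  shows "a(i := a i - s * p) \<in> garding_cone"
proof (rule cone_down[OF assms(1)])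
  have "s * (p * dR i a) \<le> s * R a" using assms by (intro mult_left_mono) auto
  also have "\<dots> < 1 * R a" using assms R_pos by (intro mult_strict_right_mono) auto
  finally show "R (a(i := a i - s * p)) > 0" by (simp add: R_affine' mult.assoc)
qed (use assms in simp)

text \<open>Convexity of the cone is concavity of \<open>R / dR i\<close>.\<close>
lemma ratio_concave:
  assumes "x \<in> garding_cone" "y \<in> garding_cone" "0 \<le> p" "0 \<le> q"
    and "p * dR i x \<le> R x" "q * dR i y \<le> R y" "0 \<le> \<theta>" "\<theta> \<le> 1"
  shows "(\<theta> * p + (1 - \<theta>) * q) * dR i (\<lambda>v. \<theta> * x v + (1 - \<theta>) * y v) \<le> R (\<lambda>v. \<theta> * x v + (1 - \<theta>) * y v)"
proof -
  consider "\<theta> = 0" | "\<theta> = 1" | "0 < \<theta>" "\<theta> < 1" using assms by fastforce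
  then show ?thesis
  proof cases
    case 3
    show ?thesis
    proof (rule le_by_scaling)
      fix s :: real assume s: "0 \<le> s" "s < 1"
      let ?z = "\<lambda>v. \<theta> * x v + (1 - \<theta>) * y v"
      have "(\<lambda>v. \<theta> * (x(i := x i - s * p)) v + (1 - \<theta>) * (y(i := y i - s * q)) v) \<in> garding_cone"
        using 3 s assms by (intro cone_add cone_scale cone_down_ratio) auto
      moreover have "(\<lambda>v. \<theta> * (x(i := x i - s * p)) v + (1 - \<theta>) * (y(i := y i - s * q)) v) =
          ?z(i := ?z i - s * (\<theta> * p + (1 - \<theta>) * q))"
        by (auto simp: algebra_simps)
      ultimately have "R (?z(i := ?z i - s * (\<theta> * p + (1 - \<theta>) * q))) > 0" using R_pos by simp
      then show "s * ((\<theta> * p + (1 - \<theta>) * q) * dR i ?z) \<le> R ?z"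
        unfolding R_affine'[of ?z i] by (simp add: mult.assoc)
    qed
  qed (use assms in simp_all)
qed

text \<open>By \<open>cone_mono\<close>, the room for lowering coordinate \<open>i\<close> inside
  the cone persists when coordinates are raised.\<close>

lemma ratio_mono:
  assumes a: "a \<in> garding_cone" and s: "0 \<le> s" "s * dR i a \<le> R a" and le: "\<And>v. a v \<le> b v"
  shows "s * dR i b \<le> R b"
proof (rule le_by_scaling)
  fix r :: real assume r: "0 \<le> r" "r < 1"
  have "b(i := b i - r * s) \<in> garding_cone"
    by (rule cone_mono[OF cone_down_ratio[OF a r s]]) (use le in simp)
  from R_pos[OF this] show "r * (s * dR i b) \<le> R b" by (simp add: R_affine' mult.assoc)
qed

text \<open>Splitting off one variable of \<open>L\<close> by affinity leaves a term s times a
  difference, whose derivative at 0 is \<open>dR l z\<close>.\<close>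

lemma R_derivative:
  assumes "finite L"
  shows "((\<lambda>s. R (\<lambda>v. z v + s * (if v \<in> L then 1 else 0))) has_real_derivative (\<Sum>l\<in>L. dR l z)) (at 0)"
  using assms
proof (induction L arbitrary: z)
  case (insert l L)
  let ?g = "\<lambda>z s. R (\<lambda>v. z v + s * (if v \<in> L then 1 else 0))"
  have eq: "R (\<lambda>v. z v + s * (if v \<in> insert l L then 1 else 0)) =
      ?g z s + s * (?g (z(l := z l + 1)) s - ?g z s)" for s
  proof -
    let ?a = "\<lambda>v. z v + s * (if v \<in> L then 1 else 0)"
    have "(\<lambda>v. z v + s * (if v \<in> insert l L then 1 else 0)) = ?a(l := ?a l + s)"
      using insert.hyps by auto
    moreover have "?a(l := ?a l + 1) = (\<lambda>v. (z(l := z l + 1)) v + s * (if v \<in> L then 1 else 0))"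
      using insert.hyps by auto
    ultimately show ?thesis using R_affine[of ?a l s] by (simp add: dR_def)
  qed
  show ?case unfolding eq
    by (rule derivative_eq_intros insert.IH refl)+ (use insert.hyps in \<open>simp add: dR_def fun_upd_def\<close>)
qed simp


text \<open>The next two lemmas run with \<open>F\<close> of the form \<open>f + w \<Sum>\<^sub>l \<partial>\<^sub>l f\<close> in mind, where \<open>j\<close> is the index of \<open>w\<close>:
  moving \<open>w\<close> from 0 to -1 applies the operator \<open>1 - \<Sum>\<^sub>l \<partial>\<^sub>l\<close>.\<close>
lemma barrier_step:
  assumes z: "z \<in> garding_cone" and c: "c > 1" and L: "finite L" "j \<notin> L" "i \<notin> L" "i \<noteq> j"
    and rel: "\<And>a. a j = 0 \<Longrightarrow> (\<Sum>l\<in>L. dR l a) = dR j a"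
    and zj: "z j = 0" and ri: "c * dR i z \<le> R z" and rj: "c * dR j z \<le> R z"
  defines "z' \<equiv> \<lambda>v. z v + (if v \<in> L then c / (c - 1) else if v = j then -1 else 0)"
  shows "z' \<in> garding_cone" "c * dR i z' \<le> R z'"
proof -
  define \<delta> where "\<delta> = c / (c - 1)"
  have \<delta>: "\<delta> > 0" using c by (simp add: \<delta>_def)
  define z1 where "z1 v = z v + \<delta> * (if v \<in> L then 1 else 0)" for v
  have z1: "z1 \<in> garding_cone" by (rule cone_mono[OF z]) (use \<delta> in \<open>simp add: z1_def\<close>)
  have z1j: "z1 j = 0" using L zj by (simp add: z1_def)
  have z': "z' = z1(j := z1 j - 1)" using L by (auto simp: z'_def z1_def \<delta>_def)
  have z1le: "z v \<le> z1 v" for v using \<delta> by (simp add: z1_def)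
  \<comment> \<open>With \<open>g\<close> the mixed second derivative, lowering coordinate
    \<open>j\<close> by 1 changes the value from \<open>f\<close> to \<open>f - b\<close> and the
    derivative in \<open>i\<close> from \<open>a\<close> to \<open>a - g\<close>.\<close>
  define f a b where "f = R z1" and "a = dR i z1" and "b = dR j z1"
  define g where "g = dR i (z1(j := z1 j + 1)) - dR i z1"
  have f: "f > 0" using R_pos[OF z1] by (simp add: f_def)
  have cb: "c * b \<le> f" unfolding b_def f_def
    by (rule ratio_mono[OF z _ rj z1le]) (use c in simp)
  have "b \<ge> 0" using dR_nonneg[OF z1] by (simp add: b_def)
  then have fb: "f - b > 0"
  proof (cases "b = 0")
    case False
    then have "b < c * b" using c \<open>b \<ge> 0\<close> by simp
    then show ?thesis using cb by simp
  qed (use f in simp)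
  have Rz': "R z' = f - b" using R_affine'[of z1 j 1] by (simp add: z' f_def b_def)
  have dz': "dR i z' = a - g" using dR_affine[of i j z1 "-1"] L by (simp add: z' a_def g_def)
  show "z' \<in> garding_cone" unfolding z'
    by (rule cone_down[OF z1]) (use Rz' z' fb in simp_all)
  have up: "z1(j := z1 j + 1) \<in> garding_cone" by (rule cone_mono[OF z1]) simp
  have "c * (a - g) \<le> f - b"
  proof (cases "a = 0")
    case True
    then have "g \<ge> 0" using dR_nonneg[OF up, of i] by (simp add: g_def a_def)
    then have "c * (a - g) \<le> 0" using True c by simp
    then show ?thesis using fb by linarith
  next
    case False
    then have a: "a > 0" using dR_nonneg[OF z1, of i] by (simp add: a_def)
    have fg: "f * g \<le> a * b"
    proof -
      have "f / a * dR i (z1(j := z1 j + 1)) \<le> R (z1(j := z1 j + 1))"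
        by (rule ratio_mono[OF z1]) (use a f in \<open>simp_all add: a_def f_def\<close>)
      then have "f / a * (g + a) \<le> f + b"
        by (simp add: g_def a_def f_def b_def R_affine)
      then show ?thesis using a by (simp add: field_simps)
    qed
    \<comment> \<open>\<open>R\<close> is compared with \<open>dR i\<close> times the chord joining
      the ratio \<open>f / a\<close> at \<open>z1\<close> to the bound \<open>c\<close> at
      \<open>z\<close>. Concavity makes \<open>\<phi>\<close> nonnegative on [0, 1], and it vanishes
      at 0, so its derivative there is nonnegative.\<close>
    define \<phi> where "\<phi> \<theta> = R (\<lambda>v. \<theta> * z v + (1 - \<theta>) * z1 v)
        - (\<theta> * c + (1 - \<theta>) * (f / a)) * dR i (\<lambda>v. \<theta> * z v + (1 - \<theta>) * z1 v)" for \<theta>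
    have \<phi>nonneg: "\<phi> \<theta> \<ge> 0" if "0 \<le> \<theta>" "\<theta> \<le> 1" for \<theta>
      using ratio_concave[OF z z1, of c "f / a" i \<theta>] that c a f ri
      by (simp add: \<phi>_def a_def f_def)
    let ?h = "\<lambda>w s. R (\<lambda>v. w v + s * (if v \<in> L then 1 else 0))"
    have zz: "(\<lambda>v. \<theta> * z v + (1 - \<theta>) * z1 v) = (\<lambda>v. z1 v + (- \<theta> * \<delta>) * (if v \<in> L then 1 else 0))" for \<theta>
      by (auto simp: z1_def algebra_simps)
    have zzi: "(\<lambda>v. z1 v + s * (if v \<in> L then 1 else 0))(i := z1 i + s * (if i \<in> L then 1 else 0) + 1)
        = (\<lambda>v. (z1(i := z1 i + 1)) v + s * (if v \<in> L then 1 else 0))" for s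
      by auto
    have \<phi>_eq: "\<phi> \<theta> = ?h z1 (- \<theta> * \<delta>) - (\<theta> * c + (1 - \<theta>) * (f / a)) *
        (?h (z1(i := z1 i + 1)) (- \<theta> * \<delta>) - ?h z1 (- \<theta> * \<delta>))" for \<theta>
      unfolding \<phi>_def zz dR_def zzi ..
    \<comment> \<open>By \<open>rel\<close> the derivative along \<open>L\<close> at a point with
      coordinate \<open>j\<close> equal to 0 is \<open>dR j\<close>; this brings \<open>b\<close>
      and \<open>g\<close> into the derivative of \<open>\<phi>\<close>.\<close>
    have chain: "((\<lambda>\<theta>. ?h w (- \<theta> * \<delta>)) has_real_derivative - \<delta> * dR j w) (at 0)" if "w j = 0" for w
    proof -
      have out: "(?h w has_real_derivative dR j w) (at (- 0 * \<delta>))"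
        using R_derivative[OF L(1), of w] rel[of w] that by simp
      have inn: "((\<lambda>\<theta>. - \<theta> * \<delta>) has_real_derivative - \<delta>) (at 0)"
        by (auto intro!: derivative_eq_intros)
      show ?thesis
        using DERIV_chain2[where f = "?h w" and g = "\<lambda>\<theta>. - \<theta> * \<delta>", OF out inn]
        by (simp only: mult.commute)
    qed
    have gsym: "dR j (z1(i := z1 i + 1)) = g + b"
    proof -
      have "(z1(i := x))(j := y) = (z1(j := y))(i := x)" for x y using L by (simp add: fun_upd_twist)
      then show ?thesis using L by (simp add: dR_def g_def b_def)
    qed
    have "(\<phi> has_real_derivative (- \<delta> * b - ((c - f / a) * a + f / a * (- \<delta> * (g + b) - - \<delta> * b)))) (at 0)"
    proof -
      have d1: "((\<lambda>\<theta>. ?h z1 (- \<theta> * \<delta>)) has_real_derivative - \<delta> * b) (at 0)"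
        using chain[of z1] z1j by (simp add: b_def)
      have d2: "((\<lambda>\<theta>. ?h (z1(i := z1 i + 1)) (- \<theta> * \<delta>)) has_real_derivative - \<delta> * (g + b)) (at 0)"
        unfolding gsym[symmetric] by (rule chain[of "z1(i := z1 i + 1)"]) (use z1j L in simp)
      have d3: "((\<lambda>\<theta>. \<theta> * c + (1 - \<theta>) * (f / a)) has_real_derivative c - f / a) (at 0)"
        using a by (auto intro!: derivative_eq_intros)
      have at0: "?h (z1(i := z1 i + 1)) (- 0 * \<delta>) - ?h z1 (- 0 * \<delta>) = a"
        by (simp add: a_def dR_def fun_upd_def)
      show ?thesis unfolding \<phi>_eq[abs_def]
        by (rule DERIV_cong[OF DERIV_diff[OF d1 DERIV_mult[OF d3 DERIV_diff[OF d2 d1]]]], subst at0) simp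
    qed
    moreover have "\<phi> 0 = 0" using a by (simp add: \<phi>_def a_def f_def)
    ultimately have "0 \<le> - \<delta> * b - ((c - f / a) * a + f / a * (- \<delta> * (g + b) - - \<delta> * b))"
    proof -
      let ?l = "- \<delta> * b - ((c - f / a) * a + f / a * (- \<delta> * (g + b) - - \<delta> * b))"
      assume d: "(\<phi> has_real_derivative ?l) (at 0)" and 0: "\<phi> 0 = 0"
      show "0 \<le> ?l"
      proof (rule ccontr)
        assume "\<not> 0 \<le> ?l"
        then obtain d where d: "d > 0" "\<And>h. h > 0 \<Longrightarrow> h < d \<Longrightarrow> \<phi> (0 + h) < \<phi> 0"
          using DERIV_neg_dec_right[OF d] by (auto simp: not_le)
        have "\<phi> (min 1 (d / 2)) < 0" using d(2)[of "min 1 (d / 2)"] d(1) 0 by simp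
        then show False using \<phi>nonneg[of "min 1 (d / 2)"] d(1) by simp
      qed
    qed
    then have "0 \<le> a * (- \<delta> * b - ((c - f / a) * a + f / a * (- \<delta> * (g + b) - - \<delta> * b)))"
      using a by simp
    also have "\<dots> = f * a - \<delta> * (a * b - f * g) - c * a\<^sup>2"
      using a by (simp add: field_simps power2_eq_square)
    finally have "c * a\<^sup>2 \<le> f * a - c / (c - 1) * (a * b - f * g)" by (simp add: \<delta>_def)
    then show ?thesis by (rule barrier_arith[OF c f a cb fg])
  qed
  then show "c * dR i z' \<le> R z'" by (simp add: Rz' dz')
qed

lemma greedy_step:
  assumes z: "z \<in> garding_cone" and L: "finite L" "L \<noteq> {}" "j \<notin> L"
    and rel: "\<And>a. a j = 0 \<Longrightarrow> (\<Sum>l\<in>L. dR l a) = dR j a"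
    and zj: "z j = -1"
  obtains l where "l \<in> L" "z(j := 0, l := z l - real (card L)) \<in> garding_cone"
proof -
  define y where "y = z(j := 0)"
  have y: "y \<in> garding_cone" by (rule cone_mono[OF z]) (simp add: y_def zj)
  have zy: "z = y(j := y j - 1)" using zj by (auto simp: y_def)
  \<comment> \<open>\<open>rel\<close> turns the derivative in \<open>j\<close> into a sum over
    \<open>L\<close>, so \<open>R z\<close> is the mean over \<open>L\<close> of the values of
    \<open>R\<close> at \<open>y\<close> with one coordinate lowered by
    \<open>card L\<close>.\<close>
  have "R z = R y - (\<Sum>l\<in>L. dR l y)"
    using R_affine'[of y j 1] rel[of y] by (simp only: zy[symmetric] mult_1) (simp add: y_def)
  then have "(\<Sum>l\<in>L. R y - real (card L) * dR l y) = real (card L) * R z"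
    by (simp add: sum_subtractf sum_distrib_left[symmetric] right_diff_distrib)
  also have "\<dots> > 0" using R_pos[OF z] L by (simp add: card_gt_0_iff)
  finally obtain l where l: "l \<in> L" "R y - real (card L) * dR l y > 0"
    by (meson sum_nonpos not_le)
  have "y(l := y l - real (card L)) \<in> garding_cone"
    by (rule cone_down[OF y]) (use l in \<open>simp_all add: R_affine'\<close>)
  moreover have "y(l := y l - real (card L)) = z(j := 0, l := z l - real (card L))"
    using l L by (auto simp: y_def)
  ultimately show thesis using that l by simp
qed

end

text \<open>The index \<open>(j, 0)\<close> stands for \<open>w\<^sub>j\<close>, and \<open>(j, l)\<close> with \<open>1 \<le> l \<le> k\<close> for \<open>x\<^sub>j\<^sub>l\<close>.\<close>
locale mixed_family = stable_multiaffine F D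
  for F :: "(nat \<times> nat \<Rightarrow> complex) \<Rightarrow> complex" and D +
  fixes m k :: nat
  assumes rel: "\<And>j a. j \<in> {1..m} \<Longrightarrow> a (j, 0) = 0 \<Longrightarrow> (\<Sum>l\<in>Pair j ` {1..k}. dR l a) = dR (j, 0) a"
    and m: "m \<ge> 1" and k: "k \<ge> 1"
begin

section \<open>Iterated barrier steps and the greedy choice of blocks\<close>

lemma cone_sum:
  assumes "finite I" "I \<noteq> {}" "\<And>i. i \<in> I \<Longrightarrow> X i \<in> garding_cone"
  shows "(\<lambda>v. \<Sum>i\<in>I. X i v) \<in> garding_cone"
  using assms by (induction I rule: finite_ne_induct) (auto intro: cone_add)

text \<open>State of the barrier argument once the indices of \<open>J\<close> are processed. The
  guard \<open>l \<le> k\<close> makes each step raise exactly the finite set of coordinates that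
  \<open>barrier_step\<close> raises.\<close>

definition shifted :: "real \<Rightarrow> real \<Rightarrow> nat set \<Rightarrow> nat \<times> nat \<Rightarrow> real" where
  "shifted \<alpha> \<delta> J = (\<lambda>(j, l). if l = 0 then (if j \<in> J then - 1 else 0)
     else \<alpha> + (if j \<in> J \<and> l \<le> k then \<delta> else 0))"

lemma barrier_iterate:
  assumes c: "c > 1" and \<alpha>: "\<alpha> > 0" and R0: "R (shifted \<alpha> \<delta> {}) > 0"
    and start: "\<And>j. j \<in> {1..m} \<Longrightarrow> c * dR (j, 0) (shifted \<alpha> \<delta> {}) \<le> R (shifted \<alpha> \<delta> {})"
    and \<delta>: "\<delta> = c / (c - 1)" and J: "finite J" "J \<subseteq> {1..m}"
  shows "shifted \<alpha> \<delta> J \<in> garding_cone \<and>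
    (\<forall>i\<in>{1..m} - J. c * dR (i, 0) (shifted \<alpha> \<delta> J) \<le> R (shifted \<alpha> \<delta> J))"
  using J
proof (induction J rule: finite_induct)
  case empty
  have "shifted \<alpha> \<delta> {} \<in> garding_cone"
  proof (rule cone_boundary[OF _ R0])
    fix t :: real assume "t > 0"
    then show "(\<lambda>i. shifted \<alpha> \<delta> {} i + t) \<in> garding_cone"
      using orthant_closure[of "shifted \<alpha> \<delta> {}" t] \<alpha> by (simp add: shifted_def split: prod.splits)
  qed
  then show ?case using start by simp
next
  case (insert j J)
  let ?z = "shifted \<alpha> \<delta> J"
  have j: "j \<in> {1..m}" and J: "J \<subseteq> {1..m}" using insert.prems by auto
  have IH: "?z \<in> garding_cone" "\<And>i. i \<in> {1..m} - J \<Longrightarrow> c * dR (i, 0) ?z \<le> R ?z"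
    using insert.IH[OF J] by auto
  let ?L = "Pair j ` {1..k}"
  have eq: "shifted \<alpha> \<delta> (insert j J) =
      (\<lambda>v. ?z v + (if v \<in> ?L then c / (c - 1) else if v = (j, 0) then - 1 else 0))"
    using insert.hyps by (intro ext) (auto simp: shifted_def \<delta> split: prod.splits)
  have zj: "?z (j, 0) = 0" using insert.hyps by (simp add: shifted_def)
  have step: "shifted \<alpha> \<delta> (insert j J) \<in> garding_cone"
      "c * dR (i, 0) (shifted \<alpha> \<delta> (insert j J)) \<le> R (shifted \<alpha> \<delta> (insert j J))"
    if "i \<in> {1..m} - J" "i \<noteq> j" for i
    unfolding eq
    by (rule barrier_step[OF IH(1) c _ _ _ _ rel[OF j] zj]; use that j insert.hyps IH(2) in auto)+
  \<comment> \<open>\<open>step\<close> speaks only if another unprocessed index exists, so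
    membership is proved separately: the barrier of \<open>j\<close> allows lowering its weight by
    \<open>1 < c\<close>, and the shift of the block coordinates follows by monotonicity.\<close>
  have "shifted \<alpha> \<delta> (insert j J) \<in> garding_cone"
  proof -
    have "?z((j, 0) := ?z (j, 0) - (1 / c) * c) \<in> garding_cone"
      by (rule cone_down_ratio[OF IH(1)]) (use c IH(2) j insert.hyps in auto)
    then have sm: "?z((j, 0) := ?z (j, 0) - 1) \<in> garding_cone" using c by simp
    show ?thesis
      by (rule cone_mono[OF sm]) (use c in \<open>auto simp: eq\<close>)
  qed
  then show ?case using step(2) by auto
qed

lemma sum_if_eq:
  assumes "j \<in> {1..m}"
  shows "(\<Sum>i\<in>{1..m}. if i = j then A else B) = A + (real m - 1) * (B :: real)"
proof -
  have "(\<Sum>i\<in>{1..m}. if i = j then A else B) = A + (\<Sum>i\<in>{1..m} - {j}. B)"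
    using assms by (subst sum.remove[of _ j]) (auto intro!: sum.cong)
  then show ?thesis using assms by (simp add: card_Diff_singleton of_nat_diff)
qed

text \<open>Averaging over the index that is processed last; for that index the weight can be raised from
  1 to any \<open>y < c\<close>.\<close>
lemma averaged_barrier:
  assumes c: "c > 1" and \<alpha>: "\<alpha> > 0" and R0: "R (shifted \<alpha> \<delta> {}) > 0"
    and start: "\<And>j. j \<in> {1..m} \<Longrightarrow> c * dR (j, 0) (shifted \<alpha> \<delta> {}) \<le> R (shifted \<alpha> \<delta> {})"
    and \<delta>: "\<delta> = c / (c - 1)" and y: "0 \<le> y" "y < c"
    and N: "real m - 1 + y > 0"
    and \<rho>: "real m * \<alpha> + (real m - 1) * \<delta> \<le> \<rho> * (real m - 1 + y)"
  shows "(\<lambda>(j, l). if l = 0 then (if j \<in> {1..m} then - 1 else 0) else \<rho>) \<in> garding_cone"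
proof -
  have \<delta>0: "\<delta> > 0" using c by (simp add: \<delta>)
  \<comment> \<open>All indices but \<open>i\<close> are processed, and the weight of
    \<open>i\<close> is lowered to \<open>- y\<close>, which its barrier \<open>c > y\<close>
    permits.\<close>
  define X where "X i = (shifted \<alpha> \<delta> ({1..m} - {i}))((i, 0) := - y)" for i
  have X: "X i \<in> garding_cone" if "i \<in> {1..m}" for i
  proof -
    let ?z = "shifted \<alpha> \<delta> ({1..m} - {i})"
    have z: "?z \<in> garding_cone" "c * dR (i, 0) ?z \<le> R ?z"
      using barrier_iterate[OF c \<alpha> R0 start \<delta>, of "{1..m} - {i}"] that by auto
    have "?z((i, 0) := ?z (i, 0) - (y / c) * c) \<in> garding_cone"
      by (rule cone_down_ratio[OF z(1)]) (use z(2) c y in auto)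
    moreover have "?z((i, 0) := ?z (i, 0) - (y / c) * c) = X i"
      using c by (simp add: X_def shifted_def)
    ultimately show ?thesis by simp
  qed
  \<comment> \<open>The weight of an index in the range occurs once as \<open>- y\<close> and
    \<open>m - 1\<close> times as \<open>- 1\<close>, so this normalisation turns it into exactly
    \<open>- 1\<close>.\<close>
  have S: "(\<lambda>v. 1 / (real m - 1 + y) * (\<Sum>i\<in>{1..m}. X i v)) \<in> garding_cone"
    by (intro cone_scale cone_sum X) (use m N in auto)
  show ?thesis
  proof (rule cone_mono[OF S])
    fix v :: "nat \<times> nat"
    obtain j l where v: "v = (j, l)" by (cases v)
    have "(\<Sum>i\<in>{1..m}. X i (j, l)) \<le>
        (real m - 1 + y) * (if l = 0 then (if j \<in> {1..m} then - 1 else 0) else \<rho>)"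
    proof (cases "l = 0")
      case True
      have "X i (j, 0) = (if j \<in> {1..m} then (if i = j then - y else - 1) else 0)" if "i \<in> {1..m}" for i
        using that by (auto simp: X_def shifted_def)
      then have "(\<Sum>i\<in>{1..m}. X i (j, 0)) =
          (\<Sum>i\<in>{1..m}. (if j \<in> {1..m} then (if i = j then - y else - 1) else 0))"
        by (intro sum.cong) auto
      then show ?thesis using True sum_if_eq[of j "- y" "- 1"] by (cases "j \<in> {1..m}") auto
    next
      case False
      \<comment> \<open>Coordinate \<open>(j, l)\<close> misses the shift \<open>\<delta>\<close> in
        \<open>X j\<close>; for \<open>j\<close> outside the range it is never shifted, and index 1
        serves as a dummy for the same bound.\<close>
      have "X i (j, l) \<le> \<alpha> + (if i = (if j \<in> {1..m} then j else 1) then 0 else \<delta>)" for i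
        using False \<delta>0 by (auto simp: X_def shifted_def)
      then have "(\<Sum>i\<in>{1..m}. X i (j, l)) \<le>
          (\<Sum>i\<in>{1..m}. \<alpha> + (if i = (if j \<in> {1..m} then j else 1) then 0 else \<delta>))"
        by (rule sum_mono)
      also have "\<dots> = real m * \<alpha> + (real m - 1) * \<delta>"
        using sum_if_eq[of "if j \<in> {1..m} then j else 1" 0 \<delta>] m by (simp add: sum.distrib)
      finally show ?thesis using \<rho> False by (simp add: mult.commute)
    qed
    then show "1 / (real m - 1 + y) * (\<Sum>i\<in>{1..m}. X i v) \<le>
        (case v of (j, l) \<Rightarrow> if l = 0 then if j \<in> {1..m} then - 1 else 0 else \<rho>)"
      using N by (simp add: v pos_divide_le_eq mult.commute)
  qed
qed

lemma greedy_assignment: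
  assumes z: "(\<lambda>(j, l). if l = 0 then (if j \<in> {1..m} then - 1 else 0) else \<rho>) \<in> garding_cone"
  obtains f where "\<And>j. j \<in> {1..m} \<Longrightarrow> f j \<in> {1..k}"
    "(\<lambda>(j, l). if l = 0 then 0 else \<rho> - (if j \<in> {1..m} \<and> l = f j then real k else 0)) \<in> garding_cone"
proof -
  \<comment> \<open>The indices in \<open>J\<close> are assigned: their weights are back at 0 and
    their coordinate in block \<open>f j\<close> is lowered by \<open>k\<close>, the size of the set
    over which \<open>greedy_step\<close> averages.\<close>
  define Z where "Z J f = (\<lambda>(j, l). if l = 0 then (if j \<in> {1..m} - J then - 1 else 0)
      else \<rho> - (if j \<in> J \<and> l = f j then real k else 0))" for J and f :: "nat \<Rightarrow> nat"
  have "\<exists>f. (\<forall>j\<in>J. f j \<in> {1..k}) \<and> Z J f \<in> garding_cone" if "finite J" "J \<subseteq> {1..m}" for J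
    using that
  proof (induction J rule: finite_induct)
    case empty
    have "Z {} f = (\<lambda>(j, l). if l = 0 then (if j \<in> {1..m} then - 1 else 0) else \<rho>)" for f
      by (auto simp: Z_def)
    then show ?case using z by simp
  next
    case (insert j J)
    then obtain f where f: "\<forall>j\<in>J. f j \<in> {1..k}" "Z J f \<in> garding_cone" by auto
    have j: "j \<in> {1..m}" using insert.prems by simp
    have zj: "Z J f (j, 0) = - 1" using j insert.hyps by (simp add: Z_def)
    obtain v where v: "v \<in> Pair j ` {1..k}"
        "(Z J f)((j, 0) := 0, v := Z J f v - real (card (Pair j ` {1..k}))) \<in> garding_cone"
      by (rule greedy_step[OF f(2) _ _ _ rel[OF j] zj]) (use k in auto)
    then obtain l where l: "l \<in> {1..k}" "v = (j, l)" by auto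
    have "card (Pair j ` {1..k}) = k" by (simp add: card_image inj_on_def)
    then have "(Z J f)((j, 0) := 0, v := Z J f v - real (card (Pair j ` {1..k}))) = Z (insert j J) (f(j := l))"
      using insert.hyps l by (intro ext) (auto simp: Z_def split: prod.splits)
    then have "Z (insert j J) (f(j := l)) \<in> garding_cone" using v by simp
    moreover have "\<forall>i\<in>insert j J. (f(j := l)) i \<in> {1..k}" using f(1) l(1) by simp
    ultimately show ?case by blast
  qed
  from this[of "{1..m}"] obtain f where f: "\<forall>j\<in>{1..m}. f j \<in> {1..k}" "Z {1..m} f \<in> garding_cone"
    by auto
  have "Z {1..m} f = (\<lambda>(j, l). if l = 0 then 0 else \<rho> - (if j \<in> {1..m} \<and> l = f j then real k else 0))"
    by (intro ext) (auto simp: Z_def)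
  then show thesis using that[of f] f by simp
qed

end

section \<open>Polynomials with an adjoined weight variable\<close>

definition poly_fun :: "(complex \<Rightarrow> complex) \<Rightarrow> bool" where
  "poly_fun g \<longleftrightarrow> (\<exists>p. \<forall>s. g s = poly p s)"

lemma poly_fun_const [intro]: "poly_fun (\<lambda>_. c)"
  unfolding poly_fun_def by (rule exI[of _ "[:c:]"]) simp

lemma poly_fun_linear [intro]: "poly_fun (\<lambda>s. a + s * b)"
  unfolding poly_fun_def by (rule exI[of _ "[:a, b:]"]) simp

lemma poly_fun_add [intro]: "poly_fun f \<Longrightarrow> poly_fun g \<Longrightarrow> poly_fun (\<lambda>s. f s + g s)"
  unfolding poly_fun_def by (metis poly_add)

lemma poly_fun_diff [intro]: "poly_fun f \<Longrightarrow> poly_fun g \<Longrightarrow> poly_fun (\<lambda>s. f s - g s)"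
  unfolding poly_fun_def by (metis poly_diff)

lemma poly_fun_mult [intro]: "poly_fun f \<Longrightarrow> poly_fun g \<Longrightarrow> poly_fun (\<lambda>s. f s * g s)"
  unfolding poly_fun_def by (metis poly_mult)

lemma poly_fun_power [intro]: "poly_fun f \<Longrightarrow> poly_fun (\<lambda>s. f s ^ n)"
  unfolding poly_fun_def by (metis poly_power)

lemma poly_fun_sum [intro]: "(\<And>i. i \<in> I \<Longrightarrow> poly_fun (f i)) \<Longrightarrow> poly_fun (\<lambda>s. \<Sum>i\<in>I. f i s)"
  by (induction I rule: infinite_finite_induct) auto

lemma poly_fun_prod [intro]: "(\<And>i. i \<in> I \<Longrightarrow> poly_fun (f i)) \<Longrightarrow> poly_fun (\<lambda>s. \<Prod>i\<in>I. f i s)"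
  by (induction I rule: infinite_finite_induct) auto

lemma poly_fun_eq_on_reals:
  assumes "poly_fun f" "poly_fun g" "\<And>t::real. f (of_real t) = g (of_real t)"
  shows "f s = g s"
proof -
  obtain p q where pq: "\<And>s. f s = poly p s" "\<And>s. g s = poly q s"
    using assms(1,2) unfolding poly_fun_def by blast
  have "infinite (range of_real :: complex set)"
    using finite_imageD[of complex_of_real UNIV] infinite_UNIV_char_0[where 'a = real]
    by (auto simp: inj_on_def)
  then have "p - q = 0"
    using poly_roots_finite[of "p - q"] infinite_super[of "range of_real" "{x. poly (p - q) x = 0}"]
      assms(3) by (auto simp: pq)
  then show ?thesis by (simp add: pq)
qed

definition homogeneous_real_form :: "nat \<Rightarrow> (('v \<Rightarrow> complex) \<Rightarrow> complex) \<Rightarrow> bool" where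
  "homogeneous_real_form D f \<longleftrightarrow> continuous_on UNIV f \<and>
    (\<forall>x v. poly_fun (\<lambda>s. f (\<lambda>i. x i + s * v i))) \<and>
    (\<forall>c x. f (\<lambda>i. c * x i) = c ^ D * f x) \<and>
    (\<forall>x. f (\<lambda>i. cnj (x i)) = cnj (f x))"

text \<open>Multiaffinity and stability as in \<open>stable_multiaffine\<close>, in predicate form
  so that they can be shown to survive products and \<open>polarize\<close>.\<close>

definition stable_form :: "nat \<Rightarrow> (('v \<Rightarrow> complex) \<Rightarrow> complex) \<Rightarrow> bool" where
  "stable_form D f \<longleftrightarrow> homogeneous_real_form D f \<and>
    (\<forall>z i t. f (z(i := z i + t)) = f z + t * (f (z(i := z i + 1)) - f z)) \<and>
    (\<forall>z. (\<forall>i. Im (z i) > 0) \<longrightarrow> f z \<noteq> 0)"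

lemma stable_form_imp_stable_multiaffine:
  assumes "stable_form D f" "Re (f (\<lambda>_. 1)) > 0"
  shows "stable_multiaffine f D"
proof -
  from assms(1) have f: "continuous_on UNIV f"
      "\<And>x v. \<exists>p. \<forall>s. f (\<lambda>i. x i + s * v i) = poly p s"
      "\<And>c x. f (\<lambda>i. c * x i) = c ^ D * f x"
      "\<And>x. f (\<lambda>i. cnj (x i)) = cnj (f x)"
      "\<And>z i t. f (z(i := z i + t)) = f z + t * (f (z(i := z i + 1)) - f z)"
      "\<And>z. (\<And>i. Im (z i) > 0) \<Longrightarrow> f z \<noteq> 0"
    unfolding stable_form_def homogeneous_real_form_def poly_fun_def by blast+
  show ?thesis
  proof
    show "f (\<lambda>i. of_real (x i) + \<i> * of_real 1) \<noteq> 0" for x by (rule f(6)) simp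
  qed (rule f assms(2) | assumption)+
qed

section \<open>Adjoining a weight: f plus w times a sum of partial derivatives of f\<close>

definition polarize :: "'v \<Rightarrow> 'v set \<Rightarrow> (('v \<Rightarrow> complex) \<Rightarrow> complex) \<Rightarrow> ('v \<Rightarrow> complex) \<Rightarrow> complex" where
  "polarize w L f z = f z + z w * (\<Sum>l\<in>L. f (z(l := z l + 1)) - f z)"

lemma continuous_on_compose_fun:
  assumes "continuous_on UNIV f" "\<And>i. continuous_on S (\<lambda>x. g x i)"
  shows "continuous_on S (\<lambda>x. f (g x))"
  by (rule continuous_on_compose2[OF assms(1)])
     (auto intro: continuous_on_coordinatewise_then_product assms)

lemma Im_minus_inverse: "Im (- inverse z) = Im z / (cmod z)\<^sup>2"
  by (simp add: cmod_power2)

text \<open>If r, a partial derivative divided by \<open>f\<close>, had positive imaginary part,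
  then - 1 / r would lie in the upper half-plane, and moving variable \<open>l\<close> by it would
  reach a zero of \<open>f\<close>, against stability.\<close>

lemma Im_sum_partials_le_0:
  assumes f: "stable_form D f" and z: "\<And>i. Im (z i) > 0"
  shows "Im ((\<Sum>l\<in>L. f (z(l := z l + 1)) - f z) / f z) \<le> 0"
proof -
  have "Im ((f (z(l := z l + 1)) - f z) / f z) \<le> 0" for l
  proof (rule ccontr)
    define g where "g = f (z(l := z l + 1)) - f z"
    assume "\<not> Im ((f (z(l := z l + 1)) - f z) / f z) \<le> 0"
    then have Im: "Im (g / f z) > 0" by (simp add: g_def)
    then have nz: "g \<noteq> 0" "f z \<noteq> 0" by auto
    define r where "r = g / f z"
    have "Im r > 0" "r \<noteq> 0" using Im nz unfolding r_def by auto
    define t where "t = - inverse r"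
    have "Im t = Im r / (cmod r)\<^sup>2" by (simp only: t_def Im_minus_inverse)
    also have "\<dots> > 0" using \<open>Im r > 0\<close> \<open>r \<noteq> 0\<close> by (intro divide_pos_pos) auto
    finally have "Im t > 0" .
    then have "f (z(l := z l + t)) \<noteq> 0"
      using f z unfolding stable_form_def by (metis add_pos_pos fun_upd_apply plus_complex.sel(2))
    moreover have "f (z(l := z l + t)) = f z + t * g"
      using f unfolding stable_form_def g_def by blast
    ultimately show False using nz by (simp add: t_def r_def)
  qed
  then have "(\<Sum>l\<in>L. Im ((f (z(l := z l + 1)) - f z) / f z)) \<le> 0" by (intro sum_nonpos)
  then show ?thesis by (simp only: sum_divide_distrib Im_sum)
qed

text \<open>A zero forces the weight to be - 1 / q, with q the sum of the partial derivatives over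
  \<open>f\<close>; as \<open>Im q \<le> 0\<close>, the weight is then not in the upper half-plane.
  The weight restores the degree that differentiation lowers, so \<open>D\<close> is
  unchanged.\<close>

lemma stable_form_polarize:
  assumes f: "stable_form D f" and D: "D > 0" and w: "w \<notin> L"
    and indep: "\<And>z t. f (z(w := t)) = f z"
  shows "stable_form D (polarize w L f)"
proof -
  define G where "G l z = f (z(l := z l + 1)) - f z" for l z
  have pol: "polarize w L f = (\<lambda>z. f z + z w * (\<Sum>l\<in>L. G l z))"
    by (auto simp: polarize_def G_def)
  from f have cont: "continuous_on UNIV f"
    and line: "\<And>x v. poly_fun (\<lambda>s. f (\<lambda>i. x i + s * v i))"
    and hom: "\<And>c x. f (\<lambda>i. c * x i) = c ^ D * f x"
    and cnj: "\<And>x. f (\<lambda>i. cnj (x i)) = cnj (f x)"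
    and aff: "\<And>z i t. f (z(i := z i + t)) = f z + t * (f (z(i := z i + 1)) - f z)"
    and stab: "\<And>z. (\<And>i. Im (z i) > 0) \<Longrightarrow> f z \<noteq> 0"
    unfolding stable_form_def homogeneous_real_form_def by blast+
  have Gw: "G l (z(w := t)) = G l z" if "l \<in> L" for l z t
  proof -
    have "l \<noteq> w" using that w by blast
    then have "(z(w := t))(l := z l + 1) = (z(l := z l + 1))(w := t)" by (simp add: fun_upd_twist)
    then show ?thesis using \<open>l \<noteq> w\<close> by (simp add: G_def indep)
  qed
  have Gaff: "G l (z(i := z i + t)) = G l z + t * (G l (z(i := z i + 1)) - G l z)" for l z i t
  proof (cases "l = i")
    case True
    have "G i (z(i := z i + s)) = G i z" for s
    proof -
      have "G i (z(i := z i + s)) = f (z(i := z i + (s + 1))) - f (z(i := z i + s))"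
        by (simp add: G_def add.assoc)
      also have "\<dots> = G i z"
        unfolding aff[of z i "s + 1"] aff[of z i s] G_def by (simp only: distrib_right) simp
      finally show ?thesis .
    qed
    then show ?thesis using True by simp
  next
    case False
    then have tw: "(z(i := x))(l := y) = (z(l := y))(i := x)" for x y by (simp add: fun_upd_twist)
    show ?thesis
      using False aff[of z i t] aff[of "z(l := z l + 1)" i t] by (simp add: G_def tw algebra_simps)
  qed
  have "continuous_on UNIV (polarize w L f)"
    unfolding pol G_def
  proof (intro continuous_intros continuous_on_compose_fun[OF cont])
    fix l i
    show "continuous_on UNIV (\<lambda>x::'a \<Rightarrow> complex. (x(l := x l + 1)) i)"
      by (cases "i = l") (auto intro!: continuous_intros)
  qed auto
  moreover have "poly_fun (\<lambda>s. polarize w L f (\<lambda>i. x i + s * v i))" for x v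
  proof -
    have "(\<lambda>i. x i + s * v i)(l := x l + s * v l + 1) = (\<lambda>i. (x(l := x l + 1)) i + s * v i)" for l s
      by auto
    then have "poly_fun (\<lambda>s. G l (\<lambda>i. x i + s * v i))" for l
      unfolding G_def by (simp only:) (intro poly_fun_diff line)
    then show ?thesis unfolding pol by (intro poly_fun_add poly_fun_mult poly_fun_sum line poly_fun_linear)
  qed
  moreover have "polarize w L f (\<lambda>i. c * x i) = c ^ D * polarize w L f x" for c x
  proof (cases "c = 0")
    case True
    then show ?thesis using hom[of 0 x] D by (simp add: pol)
  next
    case False
    \<comment> \<open>A step of length \<open>c\<close> at \<open>c x\<close> is the scaled unit
      step at \<open>x\<close>, and by affinity it changes \<open>f\<close> by \<open>c\<close>
      times a unit difference.\<close>
    have cG: "c * G l (\<lambda>i. c * x i) = c ^ D * G l x" for l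
    proof -
      have "(\<lambda>i. c * x i)(l := c * x l + c) = (\<lambda>i. c * (x(l := x l + 1)) i)"
        by (auto simp: algebra_simps)
      then show ?thesis using aff[of "\<lambda>i. c * x i" l c] hom[of c x] hom[of c "x(l := x l + 1)"]
        by (simp add: G_def algebra_simps del: fun_upd_apply)
    qed
    have "c * x w * (\<Sum>l\<in>L. G l (\<lambda>i. c * x i)) = x w * (\<Sum>l\<in>L. c * G l (\<lambda>i. c * x i))"
      by (simp add: sum_distrib_left mult_ac)
    also have "\<dots> = c ^ D * (x w * (\<Sum>l\<in>L. G l x))"
      by (simp add: cG sum_distrib_left mult_ac)
    finally show ?thesis by (simp add: pol hom distrib_left)
  qed
  moreover have "polarize w L f (\<lambda>i. cnj (x i)) = cnj (polarize w L f x)" for x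
  proof -
    have "(\<lambda>i. cnj (x i))(l := cnj (x l) + 1) = (\<lambda>i. cnj ((x(l := x l + 1)) i))" for l by auto
    then have "G l (\<lambda>i. cnj (x i)) = cnj (G l x)" for l
      by (simp add: G_def cnj del: fun_upd_apply)
    then show ?thesis by (simp add: pol cnj)
  qed
  moreover have "polarize w L f (z(i := z i + t)) = polarize w L f z +
      t * (polarize w L f (z(i := z i + 1)) - polarize w L f z)" for z i t
  proof (cases "i = w")
    case True
    then have "(\<Sum>l\<in>L. G l (z(i := x))) = (\<Sum>l\<in>L. G l z)" for x by (intro sum.cong) (auto simp: Gw)
    then show ?thesis using True by (simp add: pol indep algebra_simps)
  next
    case False
    have zw: "(z(i := x)) w = z w" for x using False by simp
    have sums: "(\<Sum>l\<in>L. G l (z(i := z i + t))) =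
        (\<Sum>l\<in>L. G l z) + t * ((\<Sum>l\<in>L. G l (z(i := z i + 1))) - (\<Sum>l\<in>L. G l z))"
      by (subst Gaff) (simp add: sum.distrib sum_distrib_left[symmetric] sum_subtractf)
    show ?thesis unfolding pol zw sums aff[of z i t] by (simp only: algebra_simps)
  qed
  moreover have "polarize w L f z \<noteq> 0" if z: "\<And>i. Im (z i) > 0" for z
  proof
    assume zero: "polarize w L f z = 0"
    define q where "q = (\<Sum>l\<in>L. G l z) / f z"
    have nz: "f z \<noteq> 0" by (rule stab[OF z])
    have q: "Im q \<le> 0" unfolding q_def G_def by (rule Im_sum_partials_le_0[OF f z])
    have zq: "z w * q = - 1" using zero nz by (simp add: pol q_def field_simps add_eq_0_iff)
    then have "q \<noteq> 0" by auto
    then have "z w = - inverse q" using zq by (simp add: field_simps)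
    then have "Im (z w) = Im q / (cmod q)\<^sup>2" by (simp only: Im_minus_inverse)
    also have "\<dots> \<le> 0" using q by (simp add: divide_nonpos_nonneg)
    finally show False using z[of w] by simp
  qed
  ultimately show ?thesis unfolding stable_form_def homogeneous_real_form_def by blast
qed

lemma polarize_indep:
  assumes "v \<noteq> w" "v \<notin> L" "\<And>z t. f (z(v := t)) = f z"
  shows "polarize w L f (z(v := t)) = polarize w L f z"
proof -
  have "f ((z(v := t))(l := z l + 1)) = f (z(l := z l + 1))" if "l \<in> L" for l
  proof -
    have "l \<noteq> v" using that assms by blast
    then have "(z(v := t))(l := z l + 1) = (z(l := z l + 1))(v := t)" by (simp add: fun_upd_twist)
    then show ?thesis by (simp only: assms(3))
  qed
  moreover have "(z(v := t)) l = z l" if "l \<in> L" for l using that assms by auto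
  ultimately have "(\<Sum>l\<in>L. f ((z(v := t))(l := (z(v := t)) l + 1)) - f (z(v := t))) =
      (\<Sum>l\<in>L. f (z(l := z l + 1)) - f z)"
    by (intro sum.cong) (simp_all only: assms(3))
  then show ?thesis using assms by (simp add: polarize_def)
qed

text \<open>The relation is imposed only where the weight is 0: elsewhere the derivatives over
  \<open>L\<close> of a polarized function contain second-order terms that its derivative in
  \<open>w\<close> lacks.\<close>

definition derivation_var :: "'v \<Rightarrow> 'v set \<Rightarrow> (('v \<Rightarrow> complex) \<Rightarrow> complex) \<Rightarrow> bool" where
  "derivation_var w L f \<longleftrightarrow> (\<forall>z t. z w = 0 \<longrightarrow>
     f (z(w := t)) = f z + t * (\<Sum>l\<in>L. f (z(l := z l + 1)) - f z))"

lemma derivation_var_polarize_new: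
  assumes indep: "\<And>z t. f (z(w := t)) = f z" and w: "w \<notin> L"
  shows "derivation_var w L (polarize w L f)"
  unfolding derivation_var_def
proof (intro allI impI)
  fix z :: "'a \<Rightarrow> complex" and t assume z0: "z w = 0"
  have "f ((z(w := t))(l := z l + 1)) = f (z(l := z l + 1))" if "l \<in> L" for l
  proof -
    have "l \<noteq> w" using that w by blast
    then have "(z(w := t))(l := z l + 1) = (z(l := z l + 1))(w := t)" by (simp add: fun_upd_twist)
    then show ?thesis by (simp only: indep)
  qed
  moreover have "(z(w := t)) l = z l" if "l \<in> L" for l using that w by auto
  ultimately have "(\<Sum>l\<in>L. f ((z(w := t))(l := (z(w := t)) l + 1)) - f (z(w := t))) =
      (\<Sum>l\<in>L. f (z(l := z l + 1)) - f z)"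
    by (intro sum.cong) (simp_all only: indep)
  moreover have "(\<Sum>l\<in>L. polarize w L f (z(l := z l + 1)) - polarize w L f z) =
      (\<Sum>l\<in>L. f (z(l := z l + 1)) - f z)"
    using w z0 by (intro sum.cong) (auto simp: polarize_def)
  ultimately show "polarize w L f (z(w := t)) = polarize w L f z +
      t * (\<Sum>l\<in>L. polarize w L f (z(l := z l + 1)) - polarize w L f z)"
    by (simp add: polarize_def indep z0)
qed

text \<open>The operators of different weights commute, because mixed second differences are
  symmetric (\<open>Bsym\<close>).\<close>

lemma derivation_var_polarize_old:
  assumes f: "derivation_var v M f" and "v \<noteq> w" "v \<notin> L" "w \<notin> M"
  shows "derivation_var v M (polarize w L f)"
  unfolding derivation_var_def
proof (intro allI impI)
  fix z :: "'a \<Rightarrow> complex" and t assume z0: "z v = 0"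
  define B where "B l i = f ((z(l := z l + 1))(i := (z(l := z l + 1)) i + 1))" for l i
  define b where "b l = f (z(l := z l + 1))" for l
  have Bsym: "B l i = B i l" for l i
  proof (cases "l = i")
    case False
    then have "(z(l := x))(i := y) = (z(i := y))(l := x)" for x y by (simp add: fun_upd_twist)
    then show ?thesis using False by (simp add: B_def)
  qed simp
  define A where "A = (\<Sum>i\<in>M. b i - f z)"
  define T where "T = (\<Sum>l\<in>L. \<Sum>i\<in>M. (B l i - b l) - (b i - f z))"
  have ft: "f (z(v := t)) = f z + t * A"
    using f z0 by (simp add: derivation_var_def A_def b_def)
  have bt: "f ((z(v := t))(l := (z(v := t)) l + 1)) = b l + t * (\<Sum>i\<in>M. B l i - b l)" if "l \<in> L" for l
  proof -
    have lv: "l \<noteq> v" using that assms by blast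
    then have "(z(v := t))(l := (z(v := t)) l + 1) = (z(l := z l + 1))(v := t)" by (simp add: fun_upd_twist)
    moreover have "(z(l := z l + 1)) v = 0" using lv z0 by simp
    ultimately show ?thesis using f by (simp only: derivation_var_def B_def b_def)
  qed
  have "polarize w L f (z(v := t)) = f z + t * A +
      z w * (\<Sum>l\<in>L. (b l - f z) + t * (\<Sum>i\<in>M. (B l i - b l) - (b i - f z)))"
  proof -
    have "(\<Sum>l\<in>L. f ((z(v := t))(l := (z(v := t)) l + 1)) - f (z(v := t))) =
        (\<Sum>l\<in>L. (b l - f z) + t * (\<Sum>i\<in>M. (B l i - b l) - (b i - f z)))"
    proof (rule sum.cong[OF refl])
      fix l assume l: "l \<in> L"
      have e: "(\<Sum>i\<in>M. B l i - b l) = A + (\<Sum>i\<in>M. (B l i - b l) - (b i - f z))"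
        unfolding A_def sum_subtractf[of "\<lambda>i. B l i - b l"] by simp
      show "f ((z(v := t))(l := (z(v := t)) l + 1)) - f (z(v := t)) =
          (b l - f z) + t * (\<Sum>i\<in>M. (B l i - b l) - (b i - f z))"
        unfolding bt[OF l] ft e by (simp add: distrib_left)
    qed
    then show ?thesis using assms(2) ft by (simp add: polarize_def)
  qed
  also have "\<dots> = polarize w L f z + t * (A + z w * T)"
    unfolding polarize_def sum.distrib sum_distrib_left[symmetric] T_def[symmetric] b_def[symmetric]
    by (simp add: distrib_left mult.left_commute)
  also have "A + z w * T = (\<Sum>i\<in>M. (b i - f z) + z w * (\<Sum>l\<in>L. (B l i - b l) - (b i - f z)))"
    unfolding A_def T_def by (subst sum.swap) (simp add: sum.distrib sum_distrib_left)
  also have "\<dots> = (\<Sum>i\<in>M. polarize w L f (z(i := z i + 1)) - polarize w L f z)"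
  proof (rule sum.cong[OF refl])
    fix i assume "i \<in> M"
    then have "i \<noteq> w" using assms by blast
    then have "polarize w L f (z(i := z i + 1)) = b i + z w * (\<Sum>l\<in>L. B i l - b i)"
      by (simp add: polarize_def B_def b_def)
    moreover have "polarize w L f z = f z + z w * (\<Sum>l\<in>L. b l - f z)"
      by (simp add: polarize_def b_def)
    moreover have "(\<Sum>l\<in>L. (B l i - b l) - (b i - f z)) = (\<Sum>l\<in>L. B i l - b i) - (\<Sum>l\<in>L. b l - f z)"
      by (simp add: Bsym[of _ i] sum_subtractf[symmetric] algebra_simps)
    ultimately show "(b i - f z) + z w * (\<Sum>l\<in>L. (B l i - b l) - (b i - f z)) =
        polarize w L f (z(i := z i + 1)) - polarize w L f z"
      by (simp add: right_diff_distrib)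
  qed
  finally show "polarize w L f (z(v := t)) = polarize w L f z +
      t * (\<Sum>i\<in>M. polarize w L f (z(i := z i + 1)) - polarize w L f z)" .
qed

section \<open>Products over disjoint blocks of variables, with all weights adjoined\<close>

definition copies :: "nat \<Rightarrow> ((nat \<Rightarrow> complex) \<Rightarrow> complex) \<Rightarrow> (nat \<times> nat \<Rightarrow> complex) \<Rightarrow> complex" where
  "copies k P z = (\<Prod>l\<in>{1..k}. P (\<lambda>i. z (i, l)))"

lemma copies_upd:
  "copies k P (z((i, l) := x)) = (if l \<in> {1..k}
     then P ((\<lambda>i. z (i, l))(i := x)) * (\<Prod>l\<in>{1..k} - {l}. P (\<lambda>i. z (i, l))) else copies k P z)"
proof (cases "l \<in> {1..k}")
  case True
  have "(\<lambda>i'. (z((i, l) := x)) (i', l)) = (\<lambda>i. z (i, l))(i := x)" by auto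
  then show ?thesis using True unfolding copies_def
    by (subst prod.remove[of _ l]) (auto intro!: prod.cong arg_cong[of _ _ P])
next
  case False
  then show ?thesis unfolding copies_def by (auto intro!: prod.cong arg_cong[of _ _ P])
qed

lemma stable_form_copies:
  assumes P: "stable_form d P"
  shows "stable_form (d * k) (copies k P)"
proof -
  from P have cont: "continuous_on UNIV P"
    and line: "\<And>x v. poly_fun (\<lambda>s. P (\<lambda>i. x i + s * v i))"
    and hom: "\<And>c x. P (\<lambda>i. c * x i) = c ^ d * P x"
    and cnj: "\<And>x. P (\<lambda>i. cnj (x i)) = cnj (P x)"
    and aff: "\<And>z i t. P (z(i := z i + t)) = P z + t * (P (z(i := z i + 1)) - P z)"
    and stab: "\<And>z. (\<And>i. Im (z i) > 0) \<Longrightarrow> P z \<noteq> 0"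
    unfolding stable_form_def homogeneous_real_form_def by blast+
  have "continuous_on UNIV (copies k P)" unfolding copies_def[abs_def]
    by (intro continuous_intros continuous_on_compose_fun[OF cont]) auto
  moreover have "poly_fun (\<lambda>s. copies k P (\<lambda>i. x i + s * v i))" for x v
    unfolding copies_def by (intro poly_fun_prod line)
  moreover have "copies k P (\<lambda>i. c * x i) = c ^ (d * k) * copies k P x" for c x
    unfolding copies_def by (simp only: hom prod.distrib) (simp add: power_mult)
  moreover have "copies k P (\<lambda>i. cnj (x i)) = cnj (copies k P x)" for x
    unfolding copies_def by (simp only: cnj cnj_prod)
  moreover have "copies k P (z(v := z v + t)) = copies k P z + t * (copies k P (z(v := z v + 1)) - copies k P z)" for z v t
  proof -
    obtain i l where v: "v = (i, l)" by (cases v)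
    show ?thesis
    proof (cases "l \<in> {1..k}")
      case True
      have z: "copies k P z = P (\<lambda>i. z (i, l)) * (\<Prod>l\<in>{1..k} - {l}. P (\<lambda>i. z (i, l)))"
        using True unfolding copies_def by (subst prod.remove[of _ l]) auto
      show ?thesis unfolding v copies_upd z if_P[OF True] aff[of "\<lambda>i. z (i, l)" i t]
        by (simp add: algebra_simps)
    next
      case False
      show ?thesis unfolding v copies_upd if_not_P[OF False] by simp
    qed
  qed
  moreover have "copies k P z \<noteq> 0" if "\<And>i. Im (z i) > 0" for z
    unfolding copies_def using stab that by simp
  ultimately show ?thesis unfolding stable_form_def homogeneous_real_form_def by blast
qed

text \<open>This is the function F of the introduction with the weights 1 to \<open>n\<close>
  adjoined. Blocks are numbered from 1, so \<open>copies\<close> ignores the weight coordinates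
  \<open>(j, 0)\<close>.\<close>

fun mixed :: "nat \<Rightarrow> ((nat \<Rightarrow> complex) \<Rightarrow> complex) \<Rightarrow> nat \<Rightarrow> (nat \<times> nat \<Rightarrow> complex) \<Rightarrow> complex" where
  "mixed k P 0 = copies k P"
| "mixed k P (Suc n) = polarize (Suc n, 0) (Pair (Suc n) ` {1..k}) (mixed k P n)"

lemma mixed_indep: "j \<notin> {1..n} \<Longrightarrow> mixed k P n (z((j, 0) := t)) = mixed k P n z"
proof (induction n arbitrary: z t)
  case (Suc n)
  have IH: "mixed k P n (z((j, 0) := t)) = mixed k P n z" for z t
    by (rule Suc.IH) (use Suc.prems in auto)
  show ?case unfolding mixed.simps
    by (rule polarize_indep) (use IH Suc.prems in auto)
qed (simp add: copies_upd)

lemma stable_form_mixed: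
  assumes "stable_form d P" "d > 0" "k > 0"
  shows "stable_form (d * k) (mixed k P n)"
proof (induction n)
  case (Suc n)
  show ?case unfolding mixed.simps
  proof (rule stable_form_polarize[OF Suc.IH])
    show "mixed k P n (z((Suc n, 0) := t)) = mixed k P n z" for z t by (rule mixed_indep) simp
  qed (use assms in auto)
qed (simp add: stable_form_copies assms)

lemma mixed_derivation_var:
  "j \<in> {1..n} \<Longrightarrow> derivation_var (j, 0) (Pair j ` {1..k}) (mixed k P n)"
proof (induction n)
  case (Suc n)
  show ?case
  proof (cases "j = Suc n")
    case True
    show ?thesis unfolding True mixed.simps
    proof (rule derivation_var_polarize_new)
      show "mixed k P n (z((Suc n, 0) := t)) = mixed k P n z" for z t by (rule mixed_indep) simp
    qed auto
  next
    case False
    then have j: "j \<in> {1..n}" using Suc.prems by auto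
    show ?thesis unfolding mixed.simps
      by (rule derivation_var_polarize_old[OF Suc.IH[OF j]]) (use False in auto)
  qed
qed simp

lemma mixed_zero: "(\<And>j. z (j, 0) = 0) \<Longrightarrow> mixed k P n z = copies k P z"
  by (induction n) (simp_all add: polarize_def)

section \<open>Hyperbolic polynomials and rank-one decompositions of the identity\<close>

lemma poly_fun_prod_mset: "poly_fun (\<lambda>s. \<Prod>r\<in>#M. s - c r)"
proof (induction M)
  case (add r M)
  have "poly_fun (\<lambda>s. s - c r)" using poly_fun_linear[of "- c r" 1] by simp
  then show ?case using add by (simp add: poly_fun_mult)
qed (simp add: poly_fun_const)

text \<open>Justifies the definite description in \<open>eigs\<close>: the multiset is recovered as
  the \<open>proots\<close> of the product.\<close>

lemma linear_factors_unique:
  fixes M N :: "real multiset"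
  assumes "\<And>t. (\<Prod>r\<in>#M. t - r) = (\<Prod>r\<in>#N. t - r)"
  shows "M = N"
proof -
  define p where "p M = (\<Prod>r\<in>#M. [:- r, 1:])" for M :: "real multiset"
  have poly_p: "poly (p M) t = (\<Prod>r\<in>#M. t - r)" for M t
    unfolding p_def by (induction M) (simp_all add: algebra_simps)
  have nz: "p M \<noteq> 0" for M unfolding p_def by (auto simp: prod_mset_zero_iff)
  have proots_p: "proots (p M) = M" for M
  proof (induction M)
    case (add r M)
    have "p (add_mset r M) = [:- r, 1:] * p M" by (simp add: p_def)
    then show ?case using add nz[of M] by (simp add: proots_mult del: mult_pCons_left)
  qed (simp add: p_def)
  have "p M = p N" using assms by (simp add: poly_eq_poly_eq_iff[symmetric] poly_p fun_eq_iff)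
  then show ?thesis by (metis proots_p)
qed

section \<open>Eigenvalues and the complexified polynomial\<close>

lemma eigs_char:
  assumes "hyperbolic d h e"
  shows "size (eigs d h e x) = d" "h (t *\<^sub>R e - x) = h e * (\<Prod>r\<in>#eigs d h e x. t - r)"
proof -
  have "\<exists>!M. size M = d \<and> (\<forall>t. h (t *\<^sub>R e - x) = h e * (\<Prod>r\<in>#M. t - r))"
  proof (rule ex_ex1I)
    fix M N
    assume "size M = d \<and> (\<forall>t. h (t *\<^sub>R e - x) = h e * (\<Prod>r\<in>#M. t - r))"
      and "size N = d \<and> (\<forall>t. h (t *\<^sub>R e - x) = h e * (\<Prod>r\<in>#N. t - r))"
    then have "(\<Prod>r\<in>#M. t - r) = (\<Prod>r\<in>#N. t - r)" for t
      using assms unfolding hyperbolic_def by (metis mult_left_cancel)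
    then show "M = N" by (rule linear_factors_unique)
  qed (use assms in \<open>auto simp: hyperbolic_def\<close>)
  from theI'[OF this] show "size (eigs d h e x) = d"
    "h (t *\<^sub>R e - x) = h e * (\<Prod>r\<in>#eigs d h e x. t - r)"
    unfolding eigs_def by blast+
qed

text \<open>The monomial sum is evaluated at complex arguments. Division by \<open>c\<close> serves
  to normalise the value at \<open>e\<close> to 1, with \<open>c = h e\<close>.\<close>

lemma complexification_exists:
  fixes h :: "real^'n \<Rightarrow> real"
  assumes "hom_poly d h"
  obtains f :: "('n \<Rightarrow> complex) \<Rightarrow> complex"
  where "homogeneous_real_form d f" "\<And>x. f (\<lambda>i. of_real (x $ i)) = of_real (h x / c)"
proof -
  obtain A a where A: "finite A" "\<And>\<alpha>. \<alpha> \<in> A \<Longrightarrow> (\<Sum>i\<in>UNIV. \<alpha> i) = d"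
      "\<And>x. h x = (\<Sum>\<alpha>\<in>A. a \<alpha> * (\<Prod>i\<in>UNIV. (x $ i) ^ \<alpha> i))"
    using assms unfolding hom_poly_def by blast
  define f where "f z = (\<Sum>\<alpha>\<in>A. of_real (a \<alpha>) * (\<Prod>i\<in>UNIV. z i ^ \<alpha> i)) * of_real (1 / c)"
    for z :: "'n \<Rightarrow> complex"
  have "continuous_on UNIV f" unfolding f_def[abs_def]
    by (intro continuous_intros) auto
  moreover have "poly_fun (\<lambda>s. f (\<lambda>i. x i + s * v i))" for x v unfolding f_def
    by (intro poly_fun_mult poly_fun_sum poly_fun_const poly_fun_prod poly_fun_power poly_fun_linear)
  moreover have "f (\<lambda>i. s * x i) = s ^ d * f x" for s x
  proof -
    have "(\<Prod>i\<in>UNIV. (s * x i) ^ \<alpha> i) = s ^ d * (\<Prod>i\<in>UNIV. x i ^ \<alpha> i)" if "\<alpha> \<in> A" for \<alpha>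
      by (simp add: power_mult_distrib prod.distrib A(2)[OF that, symmetric] power_sum)
    then show ?thesis unfolding f_def
      by (simp add: sum_distrib_left mult.left_commute cong: sum.cong)
  qed
  moreover have "f (\<lambda>i. cnj (x i)) = cnj (f x)" for x
    unfolding f_def by simp
  ultimately have "homogeneous_real_form d f" unfolding homogeneous_real_form_def by blast
  moreover have "f (\<lambda>i. of_real (x $ i)) = of_real (h x / c)" for x
    unfolding f_def A(3) by simp
  ultimately show thesis using that by blast
qed

lemma rank_le_1_prod:
  fixes M :: "real multiset"
  assumes "size (filter_mset (\<lambda>r. r \<noteq> 0) M) \<le> 1"
  shows "(\<Prod>r\<in>#M. 1 + s * r) = 1 + s * sum_mset M"
  using assms
proof (induction M)
  case (add x M)
  have zero: "(\<Prod>r\<in>#M. 1 + s * r) = 1" "sum_mset M = 0" if "filter_mset (\<lambda>r. r \<noteq> 0) M = {#}"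
    using that by (induction M) (auto split: if_splits)
  show ?case
  proof (cases "x = 0")
    case False
    then have "filter_mset (\<lambda>r. r \<noteq> 0) M = {#}" using add.prems by simp
    then show ?thesis using zero by simp
  qed (use add in simp)
qed simp

locale hyperbolic_poly =
  fixes d :: nat and h :: "real^'n \<Rightarrow> real" and e :: "real^'n" and f :: "('n \<Rightarrow> complex) \<Rightarrow> complex"
  assumes hpoly: "hyperbolic d h e" and form: "homogeneous_real_form d f"
    and f_real: "\<And>x. f (\<lambda>i. of_real (x $ i)) = of_real (h x / h e)"
begin

text \<open>Both sides are polynomials in \<open>s\<close> and agree on the reals by
  \<open>eigs_char\<close>.\<close>

lemma f_char: "f (\<lambda>i. s * of_real (e $ i) - of_real (x $ i)) = (\<Prod>r\<in>#eigs d h e x. s - of_real r)"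
proof (rule poly_fun_eq_on_reals[of _ "\<lambda>s. (\<Prod>r\<in>#eigs d h e x. s - of_real r)"])
  have "poly_fun (\<lambda>s. f (\<lambda>i. x i + s * v i))" for x v
    using form unfolding homogeneous_real_form_def by blast
  from this[of "\<lambda>i. - of_real (x $ i)" "\<lambda>i. of_real (e $ i)"]
  show "poly_fun (\<lambda>s. f (\<lambda>i. s * of_real (e $ i) - of_real (x $ i)))" by simp
  show "poly_fun (\<lambda>s. \<Prod>r\<in>#eigs d h e x. s - of_real r)" by (rule poly_fun_prod_mset)
  fix t :: real
  have "h e \<noteq> 0" using hpoly by (simp add: hyperbolic_def)
  then have "f (\<lambda>i. of_real ((t *\<^sub>R e - x) $ i)) = of_real (\<Prod>r\<in>#eigs d h e x. t - r)"
    unfolding f_real eigs_char(2)[OF hpoly] by simp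
  moreover have "(of_real (\<Prod>r\<in>#M. t - r) :: complex) = (\<Prod>r\<in>#M. of_real t - of_real r)" for M
    by (induction M) simp_all
  ultimately show "f (\<lambda>i. of_real t * of_real (e $ i) - of_real (x $ i)) =
      (\<Prod>r\<in>#eigs d h e x. of_real t - of_real r)" by simp
qed

sublocale hyperbolic_function f "\<lambda>i. e $ i" d
proof
  show "f (\<lambda>i. of_real (x i) + \<i> * of_real (e $ i)) \<noteq> 0" for x :: "'n \<Rightarrow> real"
  proof -
    have "(\<lambda>i. of_real (x i) + \<i> * of_real (e $ i)) =
        (\<lambda>i. \<i> * of_real (e $ i) - of_real ((\<chi> i. - x i) $ i))" by auto
    then have "f (\<lambda>i. of_real (x i) + \<i> * of_real (e $ i)) =
        (\<Prod>r\<in>#eigs d h e (\<chi> i. - x i). \<i> - of_real r)" by (simp only: f_char)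
    moreover have "\<i> - of_real r \<noteq> 0" for r by (simp add: complex_eq_iff)
    then have "(\<Prod>r\<in>#M. \<i> - of_real r) \<noteq> 0" for M by (induction M) auto
    ultimately show ?thesis by simp
  qed
  show "\<exists>p. \<forall>s. f (\<lambda>i. x i + s * v i) = poly p s" for x v
    using form unfolding homogeneous_real_form_def poly_fun_def by blast
qed (use form in \<open>unfold homogeneous_real_form_def, blast+\<close>)

text \<open>Taking out the factor \<open>- s\<close>, its power is distributed over the linear
  factors, of which there are \<open>d\<close>.\<close>

lemma f_add:
  assumes "s \<noteq> 0"
  shows "f (\<lambda>i. of_real (e $ i + s * x $ i)) = (\<Prod>r\<in>#eigs d h e x. 1 + of_real (s * r))"
proof -
  have "(\<lambda>i. complex_of_real (e $ i + s * x $ i)) =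
      (\<lambda>i. of_real (- s) * (of_real (- 1 / s) * of_real (e $ i) - of_real (x $ i)))"
    using assms by (auto simp: field_simps)
  then have "f (\<lambda>i. of_real (e $ i + s * x $ i)) =
      of_real (- s) ^ size (eigs d h e x) * (\<Prod>r\<in>#eigs d h e x. of_real (- 1 / s) - of_real r)"
    by (simp only: hom f_char eigs_char(1)[OF hpoly])
  also have "\<dots> = (\<Prod>r\<in>#eigs d h e x. 1 + of_real (s * r))"
  proof -
    have "of_real (- s) ^ size M * (\<Prod>r\<in>#M. of_real (- 1 / s) - of_real r) =
        (\<Prod>r\<in>#M. 1 + complex_of_real (s * r))" for M
    proof (induction M)
      case (add r M)
      have "of_real (- s) * (of_real (- 1 / s) - of_real r) = 1 + complex_of_real (s * r)"
        using assms by (simp add: field_simps)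
      then show ?case using add by (simp only: size_add_mset power_Suc image_mset_add_mset prod_mset.add_mset) (metis mult.assoc mult.left_commute)
    qed simp
    then show ?thesis .
  qed
  finally show ?thesis .
qed

text \<open>Adding \<open>\<eta> e\<close> shifts all eigenvalues by \<open>\<eta> > 0\<close>. This
  puts members of \<open>hcone\<close> into the form that \<open>cone_add_closure\<close>
  expects.\<close>

lemma hcone_closure:
  assumes x: "x \<in> hcone d h e" and \<eta>: "\<eta> > 0"
  shows "(\<lambda>i. x $ i + \<eta> * e $ i) \<in> garding_cone"
  unfolding garding_cone_def
proof safe
  fix t :: real assume t: "t \<ge> 0" and z: "f (\<lambda>i. of_real (x $ i + \<eta> * e $ i + t * e $ i)) = 0"
  have "(\<lambda>i. complex_of_real (x $ i + \<eta> * e $ i + t * e $ i)) =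
      (\<lambda>i. (- 1) * (of_real (- (\<eta> + t)) * of_real (e $ i) - of_real (x $ i)))"
    by (auto simp: algebra_simps)
  then have "(\<Prod>r\<in>#eigs d h e x. of_real (- (\<eta> + t)) - complex_of_real r) = 0"
    using z by (simp only: hom f_char) simp
  then obtain r where "r \<in># eigs d h e x" "of_real (- (\<eta> + t)) - complex_of_real r = 0"
    by (auto simp: prod_mset_zero_iff)
  then have "r \<ge> 0" "r = - (\<eta> + t)"
    using x by (auto simp: hcone_def complex_eq_iff)
  then show False using \<eta> t by simp
qed

text \<open>At most one factor in \<open>f_add\<close> differs from 1, and the only nonzero
  eigenvalue, if any, is the trace.\<close>

lemma f_rank_le_1:
  assumes "hrk d h e x \<le> 1"
  shows "f (\<lambda>i. of_real (e $ i + s * x $ i)) = of_real (1 + s * htr d h e x)"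
proof (cases "s = 0")
  case True
  have "h e \<noteq> 0" using hpoly by (simp add: hyperbolic_def)
  then show ?thesis using True f_real[of e] by simp
next
  case False
  have "(\<Prod>r\<in>#M. 1 + complex_of_real (s * r)) = of_real (\<Prod>r\<in>#M. 1 + s * r)" for M
    by (induction M) simp_all
  then show ?thesis using rank_le_1_prod[of "eigs d h e x" s] assms
    unfolding f_add[OF False] by (simp add: hrk_def htr_def)
qed

end

text \<open>The witness for \<open>c\<close> minimises
  \<open>(m c \<epsilon> + (m - 1) c / (c - 1)) / (m - 1 + c)\<close>, and \<open>delta \<epsilon> m\<close> is the minimum.\<close>
lemma optimal_parameters:
  fixes m :: nat and \<epsilon> \<rho> :: real
  assumes m: "m \<ge> 1" and \<epsilon>: "real m * \<epsilon> > 1" and \<rho>: "\<rho> > delta \<epsilon> m"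
  obtains c y where "c > 1" "0 \<le> y" "y < c" "real m - 1 + y > 0"
    "real m * (c * \<epsilon>) + (real m - 1) * (c / (c - 1)) \<le> \<rho> * (real m - 1 + y)"
proof -
  define \<nu> where "\<nu> = 1 / real m"
  define w where "w = 1 - \<nu>"
  define r where "r = sqrt (\<epsilon> - \<nu> * w)"
  have \<nu>: "\<nu> > 0" "\<nu> \<le> 1" "\<epsilon> > \<nu>" using m \<epsilon> by (auto simp: \<nu>_def field_simps)
  have "\<nu> * w = \<nu> - \<nu>\<^sup>2" by (simp add: w_def power2_eq_square algebra_simps)
  \<comment> \<open>Here \<open>m \<epsilon> > 1\<close> enters: it gives \<open>r > \<nu>\<close>,
    hence a positive denominator in \<open>c\<close>.\<close>
  then have gt: "\<epsilon> - \<nu> * w > \<nu>\<^sup>2" using \<nu> by simp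
  then have "r > \<nu>" unfolding r_def using \<nu> by (simp add: real_less_rsqrt)
  have "\<epsilon> - \<nu> * w \<ge> 0" using gt zero_le_power2[of \<nu>] by linarith
  then have r2: "r\<^sup>2 = \<epsilon> - \<nu> * w" by (simp add: r_def)
  have D: "delta \<epsilon> m = (w + r)\<^sup>2" by (simp add: delta_def r_def w_def \<nu>_def)
  \<comment> \<open>The minimising value. With it \<open>c / (c - 1) = r + w\<close>, and the
    numerator and denominator of the objective, divided by \<open>m\<close>, become
    \<open>r (w + r)\<^sup>2 / (r - \<nu>)\<close> and \<open>r / (r - \<nu>)\<close>.\<close>
  define c where "c = (r + w) / (r - \<nu>)"
  have w: "w \<ge> 0" using \<nu> by (simp add: w_def)
  have c1: "c - 1 = 1 / (r - \<nu>)" using \<open>r > \<nu>\<close> by (simp add: c_def w_def field_simps)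
  then have c: "c > 1" using \<open>r > \<nu>\<close> by (smt (verit) divide_pos_pos)
  have cc: "c / (c - 1) = r + w" using \<open>r > \<nu>\<close> by (simp add: c1) (simp add: c_def)
  have rc: "(r - \<nu>) * c = r + w" using \<open>r > \<nu>\<close> by (simp add: c_def)
  have rpos: "r > 0" using \<open>r > \<nu>\<close> \<nu> by simp
  have num: "c * \<epsilon> + w * (c / (c - 1)) = r * (w + r)\<^sup>2 / (r - \<nu>)"
  proof -
    have "\<epsilon> = r\<^sup>2 + \<nu> * w" using r2 by simp
    then have "(r - \<nu>) * (c * \<epsilon> + w * (c / (c - 1))) = (r + w) * (r\<^sup>2 + \<nu> * w) + (r - \<nu>) * w * (r + w)"
      unfolding cc by (simp only: rc[symmetric] distrib_left mult.assoc)
    also have "\<dots> = r * (w + r)\<^sup>2" by (simp add: power2_eq_square algebra_simps)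
    finally show ?thesis using \<open>r > \<nu>\<close> by (simp add: eq_divide_eq mult.commute)
  qed
  have den: "w + \<nu> * c = r / (r - \<nu>)"
  proof -
    have "(r - \<nu>) * (w + \<nu> * c) = (r - \<nu>) * w + \<nu> * (r + w)"
      unfolding rc[symmetric] by (simp add: distrib_left mult.left_commute)
    also have "\<dots> = r" by (simp add: w_def algebra_simps)
    finally show ?thesis using \<open>r > \<nu>\<close> by (simp add: eq_divide_eq mult.commute)
  qed
  define S where "S = real m * (c * \<epsilon>) + (real m - 1) * (c / (c - 1))"
  have m\<nu>: "real m * \<nu> = 1" using m by (simp add: \<nu>_def)
  have mw: "real m - 1 = real m * w" using m\<nu> by (simp add: w_def right_diff_distrib)
  have "S = real m * (c * \<epsilon> + w * (c / (c - 1)))" by (simp only: S_def mw distrib_left mult.assoc)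
  also have "\<dots> = (w + r)\<^sup>2 * (real m * (w + \<nu> * c))" unfolding num den by (simp add: mult_ac)
  finally have "S = (w + r)\<^sup>2 * (real m * (w + \<nu> * c))" .
  moreover have "real m * (w + \<nu> * c) = real m - 1 + c"
    using m\<nu> by (simp add: mw distrib_left mult.assoc[symmetric])
  ultimately have S: "S = delta \<epsilon> m * (real m - 1 + c)" by (simp only: D)
  have Dpos: "delta \<epsilon> m > 0" using w rpos by (simp add: D add_nonneg_pos)
  have mc: "real m - 1 + c > 0" using m c by simp
  have Spos: "S > 0" using Dpos mc by (simp add: S)
  \<comment> \<open>The least \<open>y \<ge> 0\<close> meeting the final inequality; it stays below
    \<open>c\<close> because \<open>\<rho>\<close> strictly exceeds the minimum.\<close>
  define y where "y = max 0 (S / \<rho> - (real m - 1))"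
  have "S / \<rho> < real m - 1 + c"
    using \<rho> Dpos mc by (simp add: S pos_divide_less_eq mult.commute)
  then have "y < c" using c by (simp add: y_def)
  moreover have "S / \<rho> > 0" using Spos \<rho> Dpos by simp
  then have "real m - 1 + y > 0" by (simp add: y_def)
  moreover have "S / \<rho> \<le> real m - 1 + y" by (simp add: y_def)
  then have "S \<le> \<rho> * (real m - 1 + y)" using \<rho> Dpos by (simp add: pos_divide_le_eq mult.commute)
  ultimately show thesis using c that[of c y] by (simp add: y_def S_def)
qed

section \<open>The stable multiaffine polynomial of a rank-one decomposition\<close>

locale rank_one_frame = hyperbolic_poly d h e f
  for d and h :: "real^'n \<Rightarrow> real" and e and f +
  fixes m :: nat and u :: "nat \<Rightarrow> real^'n"
  assumes d_pos: "d > 0"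
    and u_cone: "\<And>i. i \<in> {1..m} \<Longrightarrow> u i \<in> hcone d h e"
    and u_rank: "\<And>i. i \<in> {1..m} \<Longrightarrow> hrk d h e (u i) \<le> 1"
    and u_sum: "(\<Sum>i\<in>{1..m}. u i) = e"
begin

definition P :: "(nat \<Rightarrow> complex) \<Rightarrow> complex" where
  "P z = f (\<lambda>n. \<Sum>i\<in>{1..m}. z i * of_real (u i $ n))"

lemma e_comp: "e $ n = (\<Sum>i\<in>{1..m}. u i $ n)"
  using u_sum by (metis sum_component)

lemma P_cong: "(\<And>i. i \<in> {1..m} \<Longrightarrow> z i = z' i) \<Longrightarrow> P z = P z'"
  unfolding P_def by (intro arg_cong[of _ _ f] ext sum.cong) auto

lemma P_one: "P (\<lambda>_. 1) = 1"
proof -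
  have "h e \<noteq> 0" using hpoly by (simp add: hyperbolic_def)
  have "P (\<lambda>_. 1) = f (\<lambda>n. of_real (e $ n))" unfolding P_def e_comp by simp
  then show ?thesis using f_real[of e] \<open>h e \<noteq> 0\<close> by simp
qed

lemma m_pos: "m \<ge> 1"
proof (rule ccontr)
  assume "\<not> m \<ge> 1"
  then have "P (\<lambda>_. 1) = P (\<lambda>_. 0)" unfolding P_def by simp
  also have "\<dots> = f (\<lambda>i. 0 * 0)" unfolding P_def by simp
  also have "\<dots> = 0" using d_pos by (simp only: hom) simp
  finally show False using P_one by simp
qed

lemma frame_upd:
  assumes "i \<in> {1..m}"
  shows "P (z(i := z i + t)) = f (\<lambda>n. (\<Sum>i\<in>{1..m}. z i * of_real (u i $ n)) + t * of_real (u i $ n))"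
  unfolding P_def
proof (intro arg_cong[of _ _ f] ext)
  fix n
  have "(\<Sum>j\<in>{1..m}. (z(i := z i + t)) j * of_real (u j $ n)) =
      (\<Sum>j\<in>{1..m}. z j * of_real (u j $ n) + (if j = i then t * of_real (u j $ n) else 0))"
    by (intro sum.cong) (auto simp: distrib_right)
  also have "\<dots> = (\<Sum>j\<in>{1..m}. z j * of_real (u j $ n)) + t * of_real (u i $ n)"
    using assms by (simp add: sum.distrib)
  finally show "(\<Sum>j\<in>{1..m}. (z(i := z i + t)) j * of_real (u j $ n)) =
      (\<Sum>i\<in>{1..m}. z i * of_real (u i $ n)) + t * of_real (u i $ n)" .
qed

text \<open>Rank at most one makes \<open>f\<close> affine in s along \<open>e + s u i\<close>,
  which supplies the growth bound that \<open>affine_along_rank_one\<close> turns into affinity from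
  every base point.\<close>

lemma P_affine: "P (z(i := z i + t)) = P z + t * (P (z(i := z i + 1)) - P z)"
proof (cases "i \<in> {1..m}")
  case True
  have "cmod (f (\<lambda>n. of_real (e $ n + s * u i $ n))) \<le> (1 + \<bar>htr d h e (u i)\<bar>) * (1 + s)" if "s \<ge> 0" for s
  proof -
    have "\<bar>1 + s * htr d h e (u i)\<bar> \<le> 1 + s * \<bar>htr d h e (u i)\<bar>"
      using that abs_triangle_ineq[of 1 "s * htr d h e (u i)"] by (simp add: abs_mult)
    also have "\<dots> \<le> (1 + \<bar>htr d h e (u i)\<bar>) * (1 + s)" using that by (simp add: algebra_simps)
    finally show ?thesis unfolding f_rank_le_1[OF u_rank[OF True]] by (simp only: norm_of_real)
  qed
  note A = affine_along_rank_one[OF hcone_closure[OF u_cone[OF True]] this]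
  show ?thesis
    using A[where z = "\<lambda>n. \<Sum>i\<in>{1..m}. z i * of_real (u i $ n)" and s = t]
    unfolding frame_upd[OF True] P_def[symmetric] by simp
next
  case False
  then have "P (z(i := x)) = P z" for x by (intro P_cong) auto
  then show ?thesis by simp
qed

lemma cone_add_frame:
  assumes a: "a \<in> garding_cone" and S: "finite S" "S \<subseteq> {1..m}" and c: "\<And>i. i \<in> S \<Longrightarrow> c i \<ge> 0"
  shows "(\<lambda>n. a n + (\<Sum>i\<in>S. c i * u i $ n)) \<in> garding_cone"
  using S c
proof (induction S rule: finite_induct)
  case empty
  then show ?case using a by simp
next
  case (insert i S)
  let ?b = "\<lambda>n. a n + (\<Sum>i\<in>S. c i * u i $ n)"
  have b: "?b \<in> garding_cone" using insert by auto
  have i: "i \<in> {1..m}" "c i \<ge> 0" using insert.prems by auto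
  have "(\<lambda>n. ?b n + c i * u i $ n) \<in> garding_cone"
  proof (cases "c i = 0")
    case False
    show ?thesis
    proof (rule cone_add_closure[OF b])
      fix \<eta> :: real assume "\<eta> > 0"
      then have "\<eta> / c i > 0" using False i by simp
      from cone_scale[OF hcone_closure[OF u_cone[OF i(1)] this], of "c i"] False i(2)
      show "(\<lambda>n. c i * u i $ n + \<eta> * e $ n) \<in> garding_cone" by (simp add: distrib_left)
    qed
  qed (use b in simp)
  then show ?case using insert.hyps by (simp add: add_ac)
qed

text \<open>The imaginary part of the argument of \<open>f\<close> is a positive multiple
  \<open>b0 e\<close> plus a nonnegative combination of the \<open>u i\<close>, hence in the open
  cone, and \<open>f\<close> is hyperbolic in every direction of that cone.\<close>

lemma P_stable:
  assumes z: "\<And>i. Im (z i) > 0"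
  shows "P z \<noteq> 0"
proof -
  define b0 where "b0 = Min ((\<lambda>i. Im (z i)) ` {1..m})"
  have ne: "(\<lambda>i. Im (z i)) ` {1..m} \<noteq> {}" using m_pos by simp
  have b0: "b0 > 0" "\<And>i. i \<in> {1..m} \<Longrightarrow> b0 \<le> Im (z i)"
    using Min_in[OF _ ne] z by (auto simp: b0_def)
  have "(\<lambda>n. b0 * e $ n + (\<Sum>i\<in>{1..m}. (Im (z i) - b0) * u i $ n)) \<in> garding_cone"
    using b0 by (intro cone_add_frame cone_scale cone_base) auto
  moreover have "b0 * e $ n + (\<Sum>i\<in>{1..m}. (Im (z i) - b0) * u i $ n) = (\<Sum>i\<in>{1..m}. Im (z i) * u i $ n)" for n
    by (simp add: e_comp left_diff_distrib sum_subtractf sum_distrib_left)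
  ultimately have B: "(\<lambda>n. \<Sum>i\<in>{1..m}. Im (z i) * u i $ n) \<in> garding_cone" by simp
  have "P z = f (\<lambda>n. of_real (\<Sum>i\<in>{1..m}. Re (z i) * u i $ n) +
      \<i> * of_real (\<Sum>i\<in>{1..m}. Im (z i) * u i $ n))"
    unfolding P_def by (intro arg_cong[of _ _ f] ext) (simp add: complex_eq_iff)
  then show ?thesis using cone_hyperbolic[OF B] by (simp only: not_False_eq_True)
qed

lemma stable_form_P: "stable_form d P"
proof -
  have "continuous_on UNIV P" unfolding P_def[abs_def]
    by (rule cont_compose) (intro continuous_intros, auto)
  moreover have "poly_fun (\<lambda>s. P (\<lambda>i. x i + s * v i))" for x v
  proof -
    have "P (\<lambda>i. x i + s * v i) = f (\<lambda>n. (\<Sum>i\<in>{1..m}. x i * of_real (u i $ n)) +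
        s * (\<Sum>i\<in>{1..m}. v i * of_real (u i $ n)))" for s
      unfolding P_def by (simp add: distrib_right sum.distrib sum_distrib_left mult.assoc)
    then show ?thesis using line unfolding poly_fun_def by simp
  qed
  moreover have "P (\<lambda>i. c * x i) = c ^ d * P x" for c x
    unfolding P_def hom[symmetric] by (simp add: sum_distrib_left mult.assoc)
  moreover have "P (\<lambda>i. cnj (x i)) = cnj (P x)" for x
    unfolding P_def cnj[symmetric] by (simp add: cnj_sum)
  ultimately show ?thesis unfolding stable_form_def homogeneous_real_form_def
    using P_affine P_stable by blast
qed

lemma P_hom: "P (\<lambda>i. c * x i) = c ^ d * P x"
  using stable_form_P unfolding stable_form_def homogeneous_real_form_def by blast

lemma P_one_upd:
  assumes "i \<in> {1..m}"
  shows "P ((\<lambda>_. 1)(i := 1 + t)) = 1 + t * of_real (htr d h e (u i))"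
proof -
  have "P ((\<lambda>_. 1)(i := 1 + 1)) = f (\<lambda>n. of_real (e $ n + 1 * u i $ n))"
    using frame_upd[OF assms, of "\<lambda>_. 1" 1] by (simp add: e_comp)
  also have "\<dots> = 1 + of_real (htr d h e (u i))" by (simp only: f_rank_le_1[OF u_rank[OF assms]]) simp
  finally show ?thesis using P_affine[of "\<lambda>_. 1" i t] by (simp add: P_one)
qed

text \<open>Two computations of the derivative of \<open>P\<close> at the all-ones point along
  \<open>{1..m}\<close>: the sum of the partial derivatives, which are the traces, and the
  derivative of \<open>(1 + s) ^ d\<close> given by homogeneity.\<close>

lemma trace_sum: "(\<Sum>i\<in>{1..m}. htr d h e (u i)) = real d"
proof -
  interpret S: stable_multiaffine P d
    by (rule stable_form_imp_stable_multiaffine[OF stable_form_P]) (simp add: P_one)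
  have "S.dR i (\<lambda>_. 1) = htr d h e (u i)" if "i \<in> {1..m}" for i
  proof -
    have "(\<lambda>v. complex_of_real (((\<lambda>_. 1)(i := 1 + 1)) v)) = (\<lambda>_. 1)(i := 1 + 1)" by auto
    then show ?thesis using P_one_upd[OF that, of 1]
      by (simp add: S.dR_def S.R_def P_one del: fun_upd_apply)
  qed
  moreover have "S.R (\<lambda>v. 1 + s * (if v \<in> {1..m} then 1 else 0)) = (1 + s) ^ d" for s
  proof -
    have "P (\<lambda>v. of_real (1 + s * (if v \<in> {1..m} then 1 else 0))) = P (\<lambda>v. of_real (1 + s) * 1)"
      by (rule P_cong) simp
    also have "\<dots> = of_real ((1 + s) ^ d)"
      unfolding P_hom[of "of_real (1 + s)" "\<lambda>_. 1"] P_one by simp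
    finally show ?thesis by (simp only: S.R_def Re_complex_of_real)
  qed
  ultimately have "((\<lambda>s. (1 + s) ^ d) has_real_derivative (\<Sum>i\<in>{1..m}. htr d h e (u i))) (at 0)"
    using S.R_derivative[of "{1..m}" "\<lambda>_. 1"] by simp
  moreover have "((\<lambda>s. (1 + s) ^ d) has_real_derivative real d) (at 0)"
    by (auto intro!: derivative_eq_intros)
  ultimately show ?thesis by (rule DERIV_unique)
qed

end

section \<open>From cone membership to eigenvalue bounds for the blocks\<close>

lemma of_real_fun_upd:
  "(\<lambda>v. complex_of_real ((a(i := x)) v)) = (\<lambda>v. complex_of_real (a v))(i := of_real x)"
  by auto

context rank_one_frame
begin

lemma P_const: "P (\<lambda>_. c) = c ^ d"
  using P_hom[of c "\<lambda>_. 1"] P_one by simp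

lemma P_positive_nonzero:
  assumes "\<And>i. a i > 0"
  shows "P (\<lambda>i. of_real (a i)) \<noteq> 0"
proof
  assume "P (\<lambda>i. of_real (a i)) = 0"
  then have "P (\<lambda>i. \<i> * of_real (a i)) = 0" by (simp only: P_hom mult_zero_right)
  then show False using P_stable[of "\<lambda>i. \<i> * of_real (a i)"] assms by simp
qed

text \<open>The weights are raised from 0, where the value is 1, to 1, the other variables staying
  at 1. A nonpositive end value would give a zero at a point with positive coordinates, and
  multiplying that point by \<i> contradicts stability.\<close>

lemma mixed_pos:
  assumes k: "k > 0"
  shows "Re (mixed k P m (\<lambda>_. 1)) > 0"
proof (rule ccontr)
  assume neg: "\<not> Re (mixed k P m (\<lambda>_. 1)) > 0"
  let ?F = "mixed k P m"
  have sf: "stable_form (d * k) ?F" by (rule stable_form_mixed[OF stable_form_P d_pos k])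
  then have cont: "continuous_on UNIV ?F" and hom: "\<And>c x. ?F (\<lambda>i. c * x i) = c ^ (d * k) * ?F x"
    and cnj: "\<And>x. ?F (\<lambda>i. cnj (x i)) = cnj (?F x)"
    and stab: "\<And>z. (\<And>i. Im (z i) > 0) \<Longrightarrow> ?F z \<noteq> 0"
    unfolding stable_form_def homogeneous_real_form_def by blast+
  define x where "x t v = complex_of_real (if snd v = 0 then t else 1)" for t and v :: "nat \<times> nat"
  have "continuous_on {0..1} (\<lambda>t. Re (?F (x t)))"
  proof (intro continuous_intros continuous_on_compose_fun[OF cont])
    fix v :: "nat \<times> nat"
    show "continuous_on {0..1} (\<lambda>t. x t v)"
      unfolding x_def by (cases "snd v = 0") (auto intro!: continuous_intros)
  qed
  moreover have one: "?F (x 0) = 1"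
  proof -
    have "?F (x 0) = copies k P (x 0)" by (rule mixed_zero) (simp add: x_def)
    also have "\<dots> = (\<Prod>l\<in>{1..k}. P (\<lambda>_. 1))"
      unfolding copies_def by (intro prod.cong arg_cong[of _ _ P]) (auto simp: x_def)
    finally show ?thesis by (simp add: P_one)
  qed
  moreover have "x 1 = (\<lambda>_. 1)" by (auto simp: x_def)
  ultimately obtain t where t: "0 \<le> t" "t \<le> 1" "Re (?F (x t)) = 0"
    using IVT2'[of "\<lambda>t. Re (?F (x t))" 1 0 0] neg by auto
  have "t \<noteq> 0" using t one by auto
  have "(\<lambda>i. cnj (x t i)) = x t" by (auto simp: x_def)
  then have "cnj (?F (x t)) = ?F (x t)" using cnj[of "x t"] by simp
  then have "Im (?F (x t)) = 0" by (simp add: complex_eq_iff)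
  then have "?F (x t) = 0" using t by (simp add: complex_eq_iff)
  then have "?F (\<lambda>i. \<i> * x t i) = 0" by (simp only: hom mult_zero_right)
  moreover have "Im (\<i> * x t i) > 0" for i using t(1) \<open>t \<noteq> 0\<close> by (simp add: x_def)
  ultimately show False using stab[of "\<lambda>i. \<i> * x t i"] by simp
qed

text \<open>An eigenvalue r of the block sum makes \<open>P\<close> vanish at r minus the indicator
  of \<open>S\<close>. For r < 0 the negated point is positive, so \<open>P\<close> is nonzero
  there; for \<open>k r \<ge> \<rho>\<close> scaling by \<open>k\<close> contradicts
  \<open>nz\<close>.\<close>

lemma norm_bound:
  assumes S: "S \<subseteq> {1..m}" and k: "k > 0" and \<rho>: "\<rho> \<ge> 0"
    and nz: "\<And>t. t \<ge> \<rho> \<Longrightarrow> P (\<lambda>i. of_real (t - (if i \<in> S then k else 0))) \<noteq> 0"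
  shows "hnorm d h e (\<Sum>i\<in>S. u i) \<le> \<rho> / k"
proof -
  let ?y = "\<Sum>i\<in>S. u i"
  have zero: "P (\<lambda>i. of_real (r - (if i \<in> S then 1 else 0))) = 0" if r: "r \<in># eigs d h e ?y" for r
  proof -
    have "(\<Sum>i\<in>{1..m}. complex_of_real (r - (if i \<in> S then 1 else 0)) * of_real (u i $ n)) =
        of_real r * of_real (e $ n) - of_real (?y $ n)" for n
    proof -
      have "(\<Sum>i\<in>{1..m}. (r - (if i \<in> S then 1 else 0)) * u i $ n) =
          (\<Sum>i\<in>{1..m}. r * u i $ n - (if i \<in> S then u i $ n else 0))"
        by (intro sum.cong) (auto simp: left_diff_distrib)
      also have "\<dots> = r * e $ n - ?y $ n"
        using S by (simp add: sum_subtractf e_comp sum_distrib_left sum.If_cases Int_absorb1)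
      finally have "complex_of_real (\<Sum>i\<in>{1..m}. (r - (if i \<in> S then 1 else 0)) * u i $ n) =
          of_real (r * e $ n - ?y $ n)" by (rule arg_cong)
      then show ?thesis by (simp only: of_real_sum of_real_mult of_real_diff)
    qed
    then have "P (\<lambda>i. of_real (r - (if i \<in> S then 1 else 0))) = (\<Prod>s\<in>#eigs d h e ?y. of_real r - of_real s)"
      unfolding P_def by (simp only: f_char)
    also have "\<dots> = 0" using r by (auto simp: prod_mset_zero_iff)
    finally show ?thesis .
  qed
  have "\<bar>r\<bar> \<le> \<rho> / k" if r: "r \<in># eigs d h e ?y" for r
  proof -
    have "r \<ge> 0"
    proof (rule ccontr)
      assume "\<not> r \<ge> 0"
      then have "P (\<lambda>i. of_real ((if i \<in> S then 1 else 0) - r)) \<noteq> 0"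
        by (intro P_positive_nonzero) auto
      moreover have "(\<lambda>i. complex_of_real ((if i \<in> S then 1 else 0) - r)) =
          (\<lambda>i. (- 1) * of_real (r - (if i \<in> S then 1 else 0)))" by auto
      ultimately show False using zero[OF r] by (simp only: P_hom mult_zero_right)
    qed
    moreover have "r < \<rho> / k"
    proof (rule ccontr)
      assume "\<not> r < \<rho> / k"
      then have "k * r \<ge> \<rho>" using k by (simp add: not_less pos_divide_le_eq mult.commute)
      then have "P (\<lambda>i. of_real (k * r - (if i \<in> S then k else 0))) \<noteq> 0" by (rule nz)
      moreover have "(\<lambda>i. complex_of_real (k * r - (if i \<in> S then k else 0))) =
          (\<lambda>i. of_real k * of_real (r - (if i \<in> S then 1 else 0)))"
        by (auto simp: right_diff_distrib)
      ultimately show False using zero[OF r] by (simp only: P_hom mult_zero_right)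
    qed
    ultimately show ?thesis by simp
  qed
  then show ?thesis unfolding hnorm_def using k \<rho> by (subst Max_le_iff) auto
qed

lemma assignment_exists:
  fixes k :: nat and \<epsilon> \<rho> :: real
  assumes k: "k \<ge> 1" and tr: "\<And>i. i \<in> {1..m} \<Longrightarrow> htr d h e (u i) \<le> \<epsilon>"
    and big: "real m * (real k * \<epsilon>) > 1" and \<rho>: "\<rho> > delta (real k * \<epsilon>) m"
  obtains g where "\<And>j. j \<in> {1..m} \<Longrightarrow> g j \<in> {1..k}"
    "\<And>l. l \<in> {1..k} \<Longrightarrow> hnorm d h e (\<Sum>i\<in>{i\<in>{1..m}. g i = l}. u i) \<le> \<rho> / real k"
proof -
  let ?F = "mixed k P m"
  have k0: "k > 0" using k by simp
  have sf: "stable_form (d * k) ?F" by (rule stable_form_mixed[OF stable_form_P d_pos k0])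
  interpret S: stable_multiaffine ?F "d * k"
    by (rule stable_form_imp_stable_multiaffine[OF sf mixed_pos[OF k0]])
  have rel: "(\<Sum>l\<in>Pair j ` {1..k}. S.dR l a) = S.dR (j, 0) a" if "j \<in> {1..m}" "a (j, 0) = 0" for j a
  proof -
    have "?F ((\<lambda>v. of_real (a v))((j, 0) := 1)) = ?F (\<lambda>v. of_real (a v)) +
        1 * (\<Sum>l\<in>Pair j ` {1..k}. ?F ((\<lambda>v. of_real (a v))(l := of_real (a l) + 1)) - ?F (\<lambda>v. of_real (a v)))"
      using mixed_derivation_var[OF that(1), of k P] that(2) unfolding derivation_var_def by simp
    then show ?thesis
      using that(2) by (simp add: S.dR_def S.R_def of_real_fun_upd Re_sum del: fun_upd_apply)
  qed
  interpret M: mixed_family ?F "d * k" m k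
    by unfold_locales (use rel m_pos k in auto)
  obtain c y where c: "c > 1" and y: "0 \<le> y" "y < c" and N: "real m - 1 + y > 0"
    and \<rho>': "real m * (c * (real k * \<epsilon>)) + (real m - 1) * (c / (c - 1)) \<le> \<rho> * (real m - 1 + y)"
    by (rule optimal_parameters[OF m_pos big \<rho>])
  \<comment> \<open>At the starting point the barrier function of an index is \<open>k\<close> times
    its trace over \<open>\<alpha>\<close>, one contribution per copy; this \<open>\<alpha>\<close>
    makes it at most \<open>1 / c\<close>.\<close>
  define \<alpha> where "\<alpha> = c * (real k * \<epsilon>)"
  have "real k * \<epsilon> > 0" using big by (smt (verit) mult_nonneg_nonpos of_nat_0_le_iff)
  then have \<alpha>: "\<alpha> > 0" using c by (simp add: \<alpha>_def)
  let ?z = "M.shifted \<alpha> (c / (c - 1)) {}"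
  have z: "complex_of_real (?z (j, l)) = (if l = 0 then 0 else of_real \<alpha>)" for j l
    by (simp add: M.shifted_def)
  have Fz: "?F (\<lambda>v. of_real (?z v)) = of_real (\<alpha> ^ (d * k))"
  proof -
    have "?F (\<lambda>v. of_real (?z v)) = copies k P (\<lambda>v. of_real (?z v))"
      by (rule mixed_zero) (simp add: z)
    also have "\<dots> = (\<Prod>l\<in>{1..k}. P (\<lambda>_. of_real \<alpha>))"
      unfolding copies_def by (intro prod.cong arg_cong[of _ _ P]) (auto simp: z)
    finally show ?thesis by (simp add: P_const power_mult)
  qed
  then have Rz: "S.R ?z = \<alpha> ^ (d * k)" by (simp only: S.R_def Re_complex_of_real)
  have dRx: "S.dR (j, l) ?z = \<alpha> ^ (d * k) * (htr d h e (u j) / \<alpha>)" if j: "j \<in> {1..m}" and l: "l \<in> {1..k}" for j l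
  proof -
    have "?F ((\<lambda>v. of_real (?z v))((j, l) := of_real (\<alpha> + 1))) =
        copies k P ((\<lambda>v. of_real (?z v))((j, l) := of_real (\<alpha> + 1)))"
      by (rule mixed_zero) (use l in \<open>simp add: z\<close>)
    also have "\<dots> = P ((\<lambda>_. of_real \<alpha>)(j := of_real (\<alpha> + 1))) * (\<Prod>l\<in>{1..k} - {l}. P (\<lambda>_. of_real \<alpha>))"
    proof -
      have "(\<lambda>i. complex_of_real (?z (i, l))) = (\<lambda>_. of_real \<alpha>)" if "l \<in> {1..k}" for l
        using that by (auto simp: z)
      then show ?thesis unfolding copies_upd if_P[OF l] using l
        by (intro arg_cong2[of _ _ _ _ "(*)"] prod.cong) auto
    qed
    also have "(\<lambda>_. complex_of_real \<alpha>)(j := of_real (\<alpha> + 1)) =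
        (\<lambda>i. of_real \<alpha> * ((\<lambda>_. 1)(j := 1 + of_real (1 / \<alpha>))) i)"
      using \<alpha> by (auto simp: distrib_left)
    also have "P \<dots> = of_real (\<alpha> ^ d * (1 + htr d h e (u j) / \<alpha>))"
      unfolding P_hom P_one_upd[OF j] by simp
    also have "(\<Prod>l\<in>{1..k} - {l}. P (\<lambda>_. of_real \<alpha>)) = of_real (\<alpha> ^ (d * (k - 1)))"
      using l by (simp add: P_const power_mult card_Diff_singleton)
    also have "complex_of_real (\<alpha> ^ d * (1 + htr d h e (u j) / \<alpha>)) * of_real (\<alpha> ^ (d * (k - 1))) =
        of_real (\<alpha> ^ (d * k) * (1 + htr d h e (u j) / \<alpha>))"
    proof -
      have "d * k = d + d * (k - 1)" using k by (cases k) auto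
      then have "\<alpha> ^ (d * k) = \<alpha> ^ d * \<alpha> ^ (d * (k - 1))" by (simp only: power_add)
      then show ?thesis by (simp only: of_real_mult[symmetric] mult_ac)
    qed
    finally have "S.R (?z((j, l) := \<alpha> + 1)) = \<alpha> ^ (d * k) * (1 + htr d h e (u j) / \<alpha>)"
      by (simp only: S.R_def of_real_fun_upd Re_complex_of_real)
    moreover have "?z (j, l) = \<alpha>" using l by (simp add: M.shifted_def)
    ultimately show ?thesis by (simp add: S.dR_def Rz distrib_left)
  qed
  have start: "c * S.dR (j, 0) ?z \<le> S.R ?z" if j: "j \<in> {1..m}" for j
  proof -
    have "S.dR (j, 0) ?z = (\<Sum>l\<in>Pair j ` {1..k}. S.dR l ?z)"
      by (rule rel[OF j, symmetric]) (simp add: M.shifted_def)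
    also have "\<dots> = (\<Sum>l\<in>{1..k}. S.dR (j, l) ?z)" by (simp add: sum.reindex inj_on_def)
    also have "\<dots> = real k * (\<alpha> ^ (d * k) * (htr d h e (u j) / \<alpha>))" using dRx[OF j] by simp
    finally have "c * S.dR (j, 0) ?z = \<alpha> ^ (d * k) * (c * (real k * htr d h e (u j)) / \<alpha>)" by simp
    also have "\<dots> \<le> \<alpha> ^ (d * k) * 1"
    proof (rule mult_left_mono)
      have "c * (real k * htr d h e (u j)) \<le> \<alpha>"
        unfolding \<alpha>_def using c tr[OF j] by (intro mult_left_mono) auto
      then show "c * (real k * htr d h e (u j)) / \<alpha> \<le> 1" using \<alpha> by simp
    qed (use \<alpha> in simp)
    finally show ?thesis by (simp add: Rz)
  qed
  have avg: "(\<lambda>(j, l). if l = 0 then (if j \<in> {1..m} then - 1 else 0) else \<rho>) \<in> S.garding_cone"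
    by (rule M.averaged_barrier[OF c \<alpha> _ start refl y N]) (use \<rho>' \<alpha> Rz in \<open>simp_all add: \<alpha>_def\<close>)
  obtain g where g: "\<And>j. j \<in> {1..m} \<Longrightarrow> g j \<in> {1..k}"
      and cone: "(\<lambda>(j, l). if l = 0 then 0 else \<rho> - (if j \<in> {1..m} \<and> l = g j then real k else 0)) \<in> S.garding_cone"
    using M.greedy_assignment[OF avg] by blast
  have "hnorm d h e (\<Sum>i\<in>{i\<in>{1..m}. g i = l}. u i) \<le> \<rho> / real k" if l: "l \<in> {1..k}" for l
  proof (rule norm_bound)
    have "delta (real k * \<epsilon>) m \<ge> 0" by (simp add: delta_def)
    then show "\<rho> \<ge> 0" using \<rho> by simp
    fix t assume t: "t \<ge> \<rho>"
    \<comment> \<open>Raising the cone point from \<open>\<rho>\<close> to \<open>t\<close> stays in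
      the cone, so the product over the blocks, and with it the factor of block \<open>l\<close>, is
      nonzero.\<close>
    define b where "b = (\<lambda>(j, l). if l = 0 then 0 else t - (if j \<in> {1..m} \<and> l = g j then real k else 0))"
    have "b \<in> S.garding_cone"
      by (rule S.cone_mono[OF cone]) (use t in \<open>auto simp: b_def split: prod.splits\<close>)
    then have "?F (\<lambda>v. of_real (b v)) \<noteq> 0" by (rule S.cone_nonzero)
    moreover have "?F (\<lambda>v. of_real (b v)) = copies k P (\<lambda>v. of_real (b v))"
      by (rule mixed_zero) (simp add: b_def)
    ultimately have "P (\<lambda>i. of_real (b (i, l))) \<noteq> 0" using l by (simp add: copies_def)
    moreover have "b (i, l) = t - (if i \<in> {i\<in>{1..m}. g i = l} then real k else 0)" for i
      using l by (auto simp: b_def)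
    ultimately show "P (\<lambda>i. of_real (t - (if i \<in> {i\<in>{1..m}. g i = l} then real k else 0))) \<noteq> 0"
      by (simp only: not_False_eq_True)
  qed (use k in auto)
  then show thesis using that g by blast
qed

text \<open>There are finitely many assignments, so one with the least maximal norm satisfies the
  bound for every \<open>\<rho>\<close> above the optimum, and therefore at the optimum.\<close>

lemma optimal_assignment_exists:
  fixes k :: nat and \<epsilon> :: real
  assumes k: "k \<ge> 1" and tr: "\<And>i. i \<in> {1..m} \<Longrightarrow> htr d h e (u i) \<le> \<epsilon>"
    and big: "real m * (real k * \<epsilon>) > 1"
  obtains g where "\<And>j. j \<in> {1..m} \<Longrightarrow> g j \<in> {1..k}"
    "\<And>l. l \<in> {1..k} \<Longrightarrow> hnorm d h e (\<Sum>i\<in>{i\<in>{1..m}. g i = l}. u i) \<le> delta (real k * \<epsilon>) m / real k"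
proof -
  define N where "N g l = hnorm d h e (\<Sum>i\<in>{i\<in>{1..m}. g i = l}. u i)" for g and l :: nat
  define T where "T g = Max (N g ` {1..k})" for g
  define G where "G = ({1..m} \<rightarrow>\<^sub>E {1..k})"
  have ne: "N g ` {1..k} \<noteq> {}" "finite (N g ` {1..k})" for g using k by auto
  have finG: "finite G" unfolding G_def by (intro finite_PiE) auto
  have near: "\<exists>g\<in>G. T g \<le> \<rho> / real k" if \<rho>: "\<rho> > delta (real k * \<epsilon>) m" for \<rho>
  proof -
    obtain g where g: "\<And>j. j \<in> {1..m} \<Longrightarrow> g j \<in> {1..k}" "\<And>l. l \<in> {1..k} \<Longrightarrow> N g l \<le> \<rho> / real k"
      using assignment_exists[OF k tr big \<rho>] unfolding N_def by blast
    have "{i \<in> {1..m}. restrict g {1..m} i = l} = {i \<in> {1..m}. g i = l}" for l by auto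
    then have "N (restrict g {1..m}) = N g" unfolding N_def by (simp only:)
    then have "T (restrict g {1..m}) \<le> \<rho> / real k" using g(2) ne by (simp add: T_def)
    moreover have "restrict g {1..m} \<in> G" using g(1) by (auto simp: G_def)
    ultimately show ?thesis by blast
  qed
  have "G \<noteq> {}" using near[of "delta (real k * \<epsilon>) m + 1"] by auto
  then obtain g where g: "g \<in> G" "\<And>g'. g' \<in> G \<Longrightarrow> T g \<le> T g'"
    using arg_min_if_finite[OF finG, of T] by (metis not_less)
  have "T g * real k \<le> delta (real k * \<epsilon>) m"
  proof (rule dense_ge)
    fix \<rho> assume "delta (real k * \<epsilon>) m < \<rho>"
    from near[OF this] g(2) have "T g \<le> \<rho> / real k" by force
    then show "T g * real k \<le> \<rho>" using k by (simp add: pos_le_divide_eq)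
  qed
  then have "T g \<le> delta (real k * \<epsilon>) m / real k" using k by (simp add: pos_le_divide_eq)
  then have "N g l \<le> delta (real k * \<epsilon>) m / real k" if "l \<in> {1..k}" for l
    using that ne[of g] unfolding T_def by (auto intro: order_trans[OF Max_ge])
  then show thesis using g(1) by (intro that[of g]) (auto simp: N_def G_def)
qed

end

theorem theorem1p3:
  fixes k m d :: nat and \<epsilon> :: real and h :: "real^'n \<Rightarrow> real"
    and e :: "real^'n" and u :: "nat \<Rightarrow> real^'n"
  assumes "k \<ge> 2" and "\<epsilon> > 0"
    and "hyperbolic d h e"
    and "\<forall>i\<in>{1..m}. u i \<in> hcone d h e \<and> hrk d h e (u i) \<le> 1 \<and> htr d h e (u i) \<le> \<epsilon>"
    and "(\<Sum>i\<in>{1..m}. u i) = e"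
  shows "\<exists>S :: nat \<Rightarrow> nat set.
           (\<Union>j\<in>{1..k}. S j) = {1..m} \<and>
           (\<forall>j\<in>{1..k}. \<forall>j'\<in>{1..k}. j \<noteq> j' \<longrightarrow> S j \<inter> S j' = {}) \<and>
           (\<forall>j\<in>{1..k}. hnorm d h e (\<Sum>i\<in>S j. u i) \<le> delta (real k * \<epsilon>) m / real k)"
proof -
  have "\<exists>g. (\<forall>j\<in>{1..m}. g j \<in> {1..k}) \<and>
    (\<forall>l\<in>{1..k}. hnorm d h e (\<Sum>i\<in>{i\<in>{1..m}. g i = l}. u i) \<le> delta (real k * \<epsilon>) m / real k)"
  proof (cases "d = 0")
    \<comment> \<open>In degree 0 there are no eigenvalues, so every norm is 0 and any assignment
      works.\<close>
    case True
    then have "hnorm d h e x = 0" for x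
      using eigs_char(1)[OF assms(3), of x] by (simp add: hnorm_def)
    moreover have "delta (real k * \<epsilon>) m / real k \<ge> 0" by (simp add: delta_def)
    ultimately show ?thesis using assms(1) by (intro exI[of _ "\<lambda>_. 1"]) simp
  next
    case False
    obtain f where "homogeneous_real_form d f" "\<And>x. f (\<lambda>i. of_real (x $ i)) = of_real (h x / h e)"
      using complexification_exists[of d h "h e"] assms(3) unfolding hyperbolic_def by blast
    then interpret rank_one_frame d h e f m u
      by unfold_locales (use assms False in auto)
    \<comment> \<open>The traces sum to \<open>d \<ge> 1\<close>, so
      \<open>m \<epsilon> \<ge> 1\<close>; the factor \<open>k \<ge> 2\<close> makes the inequality
      strict, as \<open>optimal_parameters\<close> requires.\<close>
    have "real d \<le> (\<Sum>i\<in>{1..m}. \<epsilon>)"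
      unfolding trace_sum[symmetric] using assms(4) by (intro sum_mono) blast
    then have "1 \<le> real m * \<epsilon>" using False by simp
    moreover have "real m * (real k * \<epsilon>) \<ge> 2 * (real m * \<epsilon>)"
      using assms(1,2) mult_right_mono[of 2 "real k" "real m * \<epsilon>"] by (simp add: mult_ac)
    ultimately have big: "real m * (real k * \<epsilon>) > 1" by linarith
    have "k \<ge> 1" using assms(1) by simp
    moreover have "htr d h e (u i) \<le> \<epsilon>" if "i \<in> {1..m}" for i using assms(4) that by blast
    ultimately obtain g where "\<And>j. j \<in> {1..m} \<Longrightarrow> g j \<in> {1..k}"
      "\<And>l. l \<in> {1..k} \<Longrightarrow>
        hnorm d h e (\<Sum>i\<in>{i\<in>{1..m}. g i = l}. u i) \<le> delta (real k * \<epsilon>) m / real k"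
      using optimal_assignment_exists[OF _ _ big] by blast
    then show ?thesis by blast
  qed
  then obtain g where g: "\<forall>j\<in>{1..m}. g j \<in> {1..k}"
    "\<forall>l\<in>{1..k}. hnorm d h e (\<Sum>i\<in>{i\<in>{1..m}. g i = l}. u i) \<le> delta (real k * \<epsilon>) m / real k"
    by blast
  show ?thesis
    by (rule exI[of _ "\<lambda>l. {i\<in>{1..m}. g i = l}"]) (use g in auto)
qed

end
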